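(* Let $\alpha\in L^1(\mathbb{R})\cap L^\infty(\mathbb{R})$ be even with $\alpha\ge0$ almost everywhere, and let $w\in C^1(\mathbb{R})$ be odd with $w(0)=0$ and $W(\eta)=\int_0^\eta w(\rho)\,d\rho\ge0$ for all $\eta$. Suppose there are $q\ge\frac43$ and $C>0$ such that $|w(\eta)|^q\le C\,W(\eta)$ for all $\eta\in\mathbb{R}$. Then for initial data $\varphi,\psi\in L^1(\mathbb{R})\cap L^\infty(\mathbb{R})$ the Cauchy problem $$u_{tt}(x,t)=\int_{\mathbb{R}} \alpha(y-x)\, w\big(u(y,t)-u(x,t)\big)\,dy,\quad x\in\mathbb{R},\ t>0,\qquad u(x,0)=\varphi(x),\ u_t(x,0)=\psi(x)$$ has a global solution, i.e. a solution $u\in C^2([0,T],L^1(\mathbb{R})\cap L^\infty(\mathbb{R}))$ for every $T>0$. *)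

theory Defs
  imports "HOL-Probability.Probability"
begin

definition inX :: "(real \<Rightarrow> real) \<Rightarrow> bool" where
  "inX f \<longleftrightarrow> f \<in> borel_measurable lborel \<and> integrable lborel f \<and>
     (\<exists>B. AE x in lborel. \<bar>f x\<bar> \<le> B)"

definition L1norm :: "(real \<Rightarrow> real) \<Rightarrow> real" where
  "L1norm f = (\<integral>x. \<bar>f x\<bar> \<partial>lborel)"

definition Linfnorm :: "(real \<Rightarrow> real) \<Rightarrow> real" where
  "Linfnorm f = real_of_ereal (esssup lborel (\<lambda>x. ereal \<bar>f x\<bar>))"

definition Xnorm :: "(real \<Rightarrow> real) \<Rightarrow> real" where
  "Xnorm f = L1norm f + Linfnorm f"

definition X_has_deriv :: "(real \<Rightarrow> real \<Rightarrow> real) \<Rightarrow> (real \<Rightarrow> real) \<Rightarrow> real \<Rightarrow> real set \<Rightarrow> bool" where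
  "X_has_deriv u v t S \<longleftrightarrow>
     ((\<lambda>s. Xnorm (\<lambda>x. (u s x - u t x) / (s - t) - v x)) \<longlongrightarrow> 0) (at t within S)"

definition X_continuous_on :: "real set \<Rightarrow> (real \<Rightarrow> real \<Rightarrow> real) \<Rightarrow> bool" where
  "X_continuous_on S u \<longleftrightarrow>
     (\<forall>t\<in>S. ((\<lambda>s. Xnorm (\<lambda>x. u s x - u t x)) \<longlongrightarrow> 0) (at t within S))"

definition C2_X :: "real \<Rightarrow> (real \<Rightarrow> real \<Rightarrow> real) \<Rightarrow> (real \<Rightarrow> real \<Rightarrow> real)
                    \<Rightarrow> (real \<Rightarrow> real \<Rightarrow> real) \<Rightarrow> bool" where
  "C2_X T u u1 u2 \<longleftrightarrow>
     (\<forall>t\<in>{0..T}. inX (u t) \<and> inX (u1 t) \<and> inX (u2 t)) \<and>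
     (\<forall>t\<in>{0..T}. X_has_deriv u (u1 t) t {0..T}) \<and>
     (\<forall>t\<in>{0..T}. X_has_deriv u1 (u2 t) t {0..T}) \<and>
     X_continuous_on {0..T} u2"

end

theory Submission
  imports Defs
begin

text \<open>
  The problem is a second order ordinary differential equation in the Banach space of bounded
  integrable functions. Its right-hand side is only locally Lipschitz, so \<open>w\<close> is made constant outside
  \<open>[-\<rho>(t), \<rho>(t)]\<close> for an explicit growing level \<open>\<rho>\<close>; the modified equation is solved globally by
  Picard iteration, and an a priori bound shows that its solution never sees the modification.

  For the bound let \<open>e = u\<^sub>t\<^sup>2/2 + P\<close> with \<open>P(x) = \<integral> \<alpha>(y - x) W(u(y) - u(x)) dy\<close>. By oddness of \<open>w\<close>
  the energy \<open>E = \<integral> u\<^sub>t\<^sup>2/2 + P/2\<close> is conserved, and \<open>e\<^sub>t = \<integral> \<alpha>(y - x) w(u(y) - u(x)) u\<^sub>t(y) dy\<close>.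
  Young's inequality with exponents 4/3 and 4, together with \<open>q \<ge> 4/3\<close>, bounds the integrand by
  \<open>\<alpha>(y - x) (1 + C W(u(y) - u(x)) + u\<^sub>t(y)\<^sup>4)\<close>, and \<open>u\<^sub>t\<^sup>4 \<le> 2 (sup e) u\<^sub>t\<^sup>2\<close>, whence
  \<open>e\<^sub>t \<le> a + b sup e\<close> with \<open>b\<close> depending on the conserved energy. So \<open>sup e\<close> grows at most
  exponentially, and with it \<open>u\<^sub>t\<close> and \<open>u\<close>.
\<close>

section \<open>The space of bounded integrable functions\<close>

text \<open>
  Functions are bounded everywhere rather than almost everywhere, so that evaluation at a point
  is a bounded linear functional and pointwise differential inequalities make sense.
\<close>

typedef bdd = "{f :: real \<Rightarrow> real. f \<in> borel_measurable borel \<and> integrable lborel f \<and> bounded (range f)}"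
  morphisms apply_bdd Bdd
  by (intro exI[of _ "\<lambda>_. 0"]) (auto simp: bounded_def)

declare [[coercion "apply_bdd :: bdd \<Rightarrow> real \<Rightarrow> real"]]

setup_lifting type_definition_bdd

lemma bdd_eqI: "(\<And>x. apply_bdd f x = apply_bdd g x) \<Longrightarrow> f = g"
  by transfer auto

lemma bdd_measurable [measurable]: "apply_bdd f \<in> borel_measurable borel"
  and bdd_integrable [simp, intro]: "integrable lborel (apply_bdd f)"
  and bdd_bounded: "bounded (range (apply_bdd f))"
  using apply_bdd[of f] by auto

lemma Bdd_apply:
  assumes "f \<in> borel_measurable borel" "integrable lborel f" "\<And>x. \<bar>f x\<bar> \<le> c"
  shows "apply_bdd (Bdd f) = f"
  using assms by (intro Bdd_inverse) (auto simp: bounded_iff)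

definition sup_norm :: "bdd \<Rightarrow> real" where "sup_norm f = (SUP x. \<bar>f x\<bar>)"
definition l1_norm :: "bdd \<Rightarrow> real" where "l1_norm f = (\<integral>x. \<bar>f x\<bar> \<partial>lborel)"

lemma sup_norm_upper: "\<bar>apply_bdd f x\<bar> \<le> sup_norm f"
  unfolding sup_norm_def
  using bdd_bounded[of f] by (intro cSUP_upper) (auto simp: bounded_iff bdd_above_def)

lemma sup_norm_least: "(\<And>x. \<bar>apply_bdd f x\<bar> \<le> c) \<Longrightarrow> sup_norm f \<le> c"
  unfolding sup_norm_def by (intro cSUP_least) auto

lemma sup_norm_nonneg [simp]: "0 \<le> sup_norm f"
  using sup_norm_upper[of f 0] by linarith

lemma l1_norm_nonneg [simp]: "0 \<le> l1_norm f"
  by (simp add: l1_norm_def)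

instantiation bdd :: real_vector
begin
lift_definition zero_bdd :: bdd is "\<lambda>_. 0" by (auto simp: bounded_def)
lift_definition uminus_bdd :: "bdd \<Rightarrow> bdd" is "\<lambda>f x. - f x"
  by (auto simp: bounded_iff)
lift_definition plus_bdd :: "bdd \<Rightarrow> bdd \<Rightarrow> bdd" is "\<lambda>f g x. f x + g x"
  by (auto intro!: bounded_plus_comp)
lift_definition minus_bdd :: "bdd \<Rightarrow> bdd \<Rightarrow> bdd" is "\<lambda>f g x. f x - g x"
  by (auto intro!: bounded_minus_comp)
lift_definition scaleR_bdd :: "real \<Rightarrow> bdd \<Rightarrow> bdd" is "\<lambda>c f x. c * f x"
  using bounded_scaleR_comp by fastforce
instance
  by standard (transfer; auto simp: algebra_simps)+
end

lemmas [simp] = zero_bdd.rep_eq uminus_bdd.rep_eq plus_bdd.rep_eq minus_bdd.rep_eq scaleR_bdd.rep_eq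

lemma sup_norm_add: "sup_norm (f + g) \<le> sup_norm f + sup_norm g"
  by (intro sup_norm_least)
    (use sup_norm_upper[of f] sup_norm_upper[of g] in \<open>auto intro: order_trans[OF abs_triangle_ineq] add_mono\<close>)

lemma l1_norm_add: "l1_norm (f + g) \<le> l1_norm f + l1_norm g"
proof -
  have "l1_norm (f + g) \<le> (\<integral>x. \<bar>f x\<bar> + \<bar>g x\<bar> \<partial>lborel)"
    unfolding l1_norm_def using bdd_integrable[of f] bdd_integrable[of g]
    by (intro integral_mono) (auto simp del: bdd_integrable)
  then show ?thesis
    by (simp add: l1_norm_def)
qed

lemma sup_norm_scaleR_le: "sup_norm (c *\<^sub>R f) \<le> \<bar>c\<bar> * sup_norm f"
  by (intro sup_norm_least) (auto simp: abs_mult intro!: mult_left_mono sup_norm_upper)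

lemma sup_norm_scaleR: "sup_norm (c *\<^sub>R f) = \<bar>c\<bar> * sup_norm f"
proof (cases "c = 0")
  case True
  then show ?thesis using sup_norm_scaleR_le[of c f] by (simp add: order_antisym)
next
  case False
  have "sup_norm f \<le> \<bar>inverse c\<bar> * sup_norm (c *\<^sub>R f)"
    using sup_norm_scaleR_le[of "inverse c" "c *\<^sub>R f"] False by simp
  then show ?thesis
    using sup_norm_scaleR_le[of c f] False by (simp add: field_simps)
qed

lemma l1_norm_scaleR: "l1_norm (c *\<^sub>R f) = \<bar>c\<bar> * l1_norm f"
  by (simp add: l1_norm_def abs_mult)

instantiation bdd :: real_normed_vector
begin
definition norm_bdd :: "bdd \<Rightarrow> real" where "norm_bdd f = sup_norm f + l1_norm f"
definition dist_bdd :: "bdd \<Rightarrow> bdd \<Rightarrow> real" where "dist_bdd f g = norm (f - g)"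
definition sgn_bdd :: "bdd \<Rightarrow> bdd" where "sgn_bdd f = f /\<^sub>R norm f"
definition uniformity_bdd :: "(bdd \<times> bdd) filter"
  where "uniformity_bdd = (INF e\<in>{0 <..}. principal {(x, y). dist x y < e})"
definition open_bdd :: "bdd set \<Rightarrow> bool"
  where "open_bdd S = (\<forall>x\<in>S. \<forall>\<^sub>F (x', y) in uniformity. x' = x \<longrightarrow> y \<in> S)"
instance
proof
  fix f g :: bdd and a :: real
  show "norm f = 0 \<longleftrightarrow> f = 0"
  proof
    assume "norm f = 0"
    then have "sup_norm f \<le> 0"
      using l1_norm_nonneg[of f] unfolding norm_bdd_def by linarith
    then show "f = 0"
      using sup_norm_upper[of f] by (intro bdd_eqI) (simp, metis abs_le_zero_iff order_trans)
  next
    assume "f = 0"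
    then show "norm f = 0"
      using sup_norm_scaleR[of 0 0] l1_norm_scaleR[of 0 0] by (simp add: norm_bdd_def)
  qed
  show "norm (f + g) \<le> norm f + norm g"
    using sup_norm_add[of f g] l1_norm_add[of f g] by (simp add: norm_bdd_def)
  show "norm (a *\<^sub>R f) = \<bar>a\<bar> * norm f"
    by (simp add: norm_bdd_def sup_norm_scaleR l1_norm_scaleR algebra_simps)
qed (simp_all add: dist_bdd_def sgn_bdd_def uniformity_bdd_def open_bdd_def)
end

lemma sup_norm_le_norm: "sup_norm f \<le> norm f" and l1_norm_le_norm: "l1_norm f \<le> norm f"
  by (simp_all add: norm_bdd_def)

lemma apply_bdd_le_norm: "\<bar>apply_bdd f x\<bar> \<le> norm f"
  using sup_norm_upper sup_norm_le_norm by (rule order_trans)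

lemma norm_bdd_leI:
  assumes "\<And>x. \<bar>apply_bdd f x\<bar> \<le> a" "(\<integral>x. \<bar>apply_bdd f x\<bar> \<partial>lborel) \<le> b"
  shows "norm f \<le> a + b"
  using sup_norm_least[OF assms(1)] assms(2) by (simp add: norm_bdd_def l1_norm_def)

text \<open>Fatou's lemma, applied to the absolute values. In the completeness proof it shows that
  the pointwise limit is integrable and that the convergence also holds in the integral
  norm.\<close>

lemma bdd_limit_l1:
  fixes F :: "nat \<Rightarrow> bdd" and g :: "real \<Rightarrow> real"
  assumes lim: "\<And>x. (\<lambda>n. F n x) \<longlonglongrightarrow> g x"
    and le: "\<And>n. l1_norm (F n) \<le> c"
  shows "g \<in> borel_measurable borel" "integrable lborel g" "(\<integral>x. \<bar>g x\<bar> \<partial>lborel) \<le> c"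
proof -
  show g [measurable]: "g \<in> borel_measurable borel"
    by (rule borel_measurable_LIMSEQ_real[OF lim]) auto
  have c: "0 \<le> c"
    using le[of 0] l1_norm_nonneg[of "F 0"] by linarith
  have "(\<integral>\<^sup>+x. ennreal \<bar>g x\<bar> \<partial>lborel) = (\<integral>\<^sup>+x. liminf (\<lambda>n. ennreal \<bar>F n x\<bar>) \<partial>lborel)"
  proof (intro nn_integral_cong)
    fix x
    have "(\<lambda>n. ennreal \<bar>F n x\<bar>) \<longlonglongrightarrow> ennreal \<bar>g x\<bar>"
      by (intro tendsto_ennrealI tendsto_rabs lim)
    then show "ennreal \<bar>g x\<bar> = liminf (\<lambda>n. ennreal \<bar>F n x\<bar>)"
      by (intro lim_imp_Liminf[symmetric]) auto
  qed
  also have "\<dots> \<le> liminf (\<lambda>n. \<integral>\<^sup>+x. ennreal \<bar>F n x\<bar> \<partial>lborel)"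
    by (rule nn_integral_liminf) simp
  also have "\<dots> = liminf (\<lambda>n. ennreal (l1_norm (F n)))"
    unfolding l1_norm_def by (subst nn_integral_eq_integral) auto
  also have "\<dots> \<le> ennreal c"
    by (rule Liminf_le) (auto intro!: always_eventually ennreal_leI le)
  finally have *: "(\<integral>\<^sup>+x. ennreal \<bar>g x\<bar> \<partial>lborel) \<le> ennreal c" .
  then show i: "integrable lborel g"
    by (intro integrableI_bounded) (auto simp: le_less_trans)
  show "(\<integral>x. \<bar>g x\<bar> \<partial>lborel) \<le> c"
    using * c by (subst (asm) nn_integral_eq_integral) (auto simp: i)
qed

text \<open>A Cauchy sequence converges at every point, because evaluation is bounded by the norm.
  The sup part of the norm passes to the pointwise limit directly, the integral part by
  \<open>bdd_limit_l1\<close>.\<close>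

instance bdd :: banach
proof
  fix X :: "nat \<Rightarrow> bdd"
  assume X: "Cauchy X"
  have "Cauchy (\<lambda>n. X n x)" for x
    unfolding Cauchy_def
  proof (intro allI impI)
    fix e :: real assume "0 < e"
    then obtain M where "\<forall>m\<ge>M. \<forall>n\<ge>M. norm (X m - X n) < e"
      using X unfolding Cauchy_def dist_norm by blast
    then show "\<exists>M. \<forall>m\<ge>M. \<forall>n\<ge>M. dist (X m x) (X n x) < e"
      using apply_bdd_le_norm[of "X _ - X _" x] by (simp add: dist_real_def) (meson le_less_trans)
  qed
  then obtain g where g: "\<And>x. (\<lambda>n. X n x) \<longlonglongrightarrow> g x"
    unfolding Cauchy_convergent_iff convergent_def by metis
  obtain B where B: "\<And>n. norm (X n) \<le> B"
    using cauchy_imp_bounded[OF X] by (auto simp: bounded_iff)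
  have gB: "\<bar>g x\<bar> \<le> B" for x
    by (rule tendsto_upperbound[OF tendsto_rabs[OF g]])
      (auto intro!: always_eventually order_trans[OF apply_bdd_le_norm B])
  have gl: "g \<in> borel_measurable borel" "integrable lborel g"
    using bdd_limit_l1[OF g, of B] order_trans[OF l1_norm_le_norm B] by auto
  have app: "apply_bdd (Bdd g) = g"
    using gl gB by (rule Bdd_apply)
  have "X \<longlonglongrightarrow> Bdd g"
  proof (rule LIMSEQ_I)
    fix e :: real assume "0 < e"
    then have "0 < e/3" by simp
    then obtain M where M: "\<And>m n. m \<ge> M \<Longrightarrow> n \<ge> M \<Longrightarrow> norm (X m - X n) < e/3"
      using X unfolding Cauchy_def dist_norm by blast
    have "norm (X n - Bdd g) < e" if n: "n \<ge> M" for n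
    proof -
      \<comment> \<open>Here \<open>n\<close> is fixed and the other index tends to infinity. The
        shift by \<open>M\<close> keeps every term of the sequence within \<open>e/3\<close> of
        \<open>X n\<close>, so both parts of the norm of the limit are at most
        \<open>e/3\<close>.\<close>
      have lim: "(\<lambda>m. (X n - X (m + M)) x) \<longlonglongrightarrow> (X n - Bdd g) x" for x
        using LIMSEQ_ignore_initial_segment[OF g, of M] by (auto simp: app intro!: tendsto_intros)
      have small: "norm (X n - X (m + M)) \<le> e/3" for m
        using M[of n "m + M"] n by simp
      have "\<bar>(X n - Bdd g) x\<bar> \<le> e/3" for x
        by (rule tendsto_upperbound[OF tendsto_rabs[OF lim]])
          (use order_trans[OF apply_bdd_le_norm small] in \<open>auto intro!: always_eventually simp del: minus_bdd.rep_eq\<close>)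
      moreover have "(\<integral>x. \<bar>(X n - Bdd g) x\<bar> \<partial>lborel) \<le> e/3"
        by (rule bdd_limit_l1(3)[OF lim]) (rule order_trans[OF l1_norm_le_norm small])
      ultimately have "norm (X n - Bdd g) \<le> e/3 + e/3"
        by (rule norm_bdd_leI)
      then show ?thesis using \<open>0 < e\<close> by simp
    qed
    then show "\<exists>M. \<forall>n\<ge>M. norm (X n - Bdd g) < e" by blast
  qed
  then show "convergent X" by (auto simp: convergent_def)
qed

section \<open>Products and continuous functionals on the space\<close>

lift_definition mult_bdd :: "bdd \<Rightarrow> bdd \<Rightarrow> bdd" is "\<lambda>f g x. f x * g x"
proof -
  fix f g :: "real \<Rightarrow> real"
  assume f: "f \<in> borel_measurable borel \<and> integrable lborel f \<and> bounded (range f)"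
    and g: "g \<in> borel_measurable borel \<and> integrable lborel g \<and> bounded (range g)"
  obtain B D where B: "\<And>x. \<bar>f x\<bar> \<le> B" and D: "\<And>x. \<bar>g x\<bar> \<le> D"
    using f g by (auto simp: bounded_iff)
  have [measurable]: "f \<in> borel_measurable borel" "g \<in> borel_measurable borel"
    using f g by auto
  have le: "\<bar>f x * g x\<bar> \<le> B * \<bar>g x\<bar>" for x
    unfolding abs_mult by (intro mult_right_mono B) auto
  have "integrable lborel (\<lambda>x. f x * g x)"
    by (rule Bochner_Integration.integrable_bound[of _ "\<lambda>x. B * \<bar>g x\<bar>"])
      (use g le in \<open>auto intro: order_trans[OF _ abs_ge_self]\<close>)
  moreover have "\<bar>f x * g x\<bar> \<le> B * D" for x
    using le[of x] mult_left_mono[OF D[of x], of B] B[of 0] by linarith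
  ultimately show "(\<lambda>x. f x * g x) \<in> borel_measurable borel \<and> integrable lborel (\<lambda>x. f x * g x)
      \<and> bounded (range (\<lambda>x. f x * g x))"
    by (auto simp: bounded_iff)
qed

lemmas [simp] = mult_bdd.rep_eq

text \<open>Taking the supremum of the first factor out of both parts of the norm gives
  \<open>sup_norm f * norm g\<close>. This provides the product rule for the kinetic term.\<close>

lemma bounded_bilinear_mult_bdd: "bounded_bilinear mult_bdd"
proof (rule bounded_bilinear.intro)
  show "\<exists>K. \<forall>a b. norm (mult_bdd a b) \<le> norm a * norm b * K"
  proof (intro exI allI)
    fix f g
    have "norm (mult_bdd f g) \<le> sup_norm f * sup_norm g + sup_norm f * l1_norm g"
    proof (rule norm_bdd_leI)
      show "\<bar>mult_bdd f g x\<bar> \<le> sup_norm f * sup_norm g" for x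
        by (auto simp: abs_mult intro!: mult_mono sup_norm_upper)
      show "(\<integral>x. \<bar>mult_bdd f g x\<bar> \<partial>lborel) \<le> sup_norm f * l1_norm g"
        unfolding l1_norm_def integral_mult_right_zero[symmetric]
        by (intro integral_mono)
          (auto simp: abs_mult simp del: mult_bdd.rep_eq intro!: mult_right_mono sup_norm_upper,
            simp_all add: abs_mult mult_right_mono sup_norm_upper)
    qed
    also have "\<dots> = sup_norm f * norm g"
      by (simp add: norm_bdd_def algebra_simps)
    also have "\<dots> \<le> norm f * norm g * 1"
      by (auto intro!: mult_right_mono sup_norm_le_norm)
    finally show "norm (mult_bdd f g) \<le> norm f * norm g * 1" .
  qed
qed (auto intro!: bdd_eqI simp: algebra_simps)

lemma bounded_linear_apply_bdd: "bounded_linear (\<lambda>f. apply_bdd f x)"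
  by (rule bounded_linear_intro[of _ 1]) (auto intro: apply_bdd_le_norm)

lemma bounded_linear_integral_bdd: "bounded_linear (\<lambda>f. \<integral>x. apply_bdd f x \<partial>lborel)"
proof (rule bounded_linear_intro[of _ 1])
  show "norm (\<integral>x. apply_bdd f x \<partial>lborel) \<le> norm f * 1" for f
    using order_trans[OF integral_abs_bound l1_norm_le_norm[of f, unfolded l1_norm_def]] by simp
qed auto

text \<open>By the triangle inequality \<open>sup_norm\<close> is 1-Lipschitz for
  \<open>norm\<close>. The continuity argument for the a priori bound relies on this.\<close>

lemma continuous_on_sup_norm:
  fixes f :: "'a::topological_space \<Rightarrow> bdd"
  assumes "continuous_on S f"
  shows "continuous_on S (\<lambda>t. sup_norm (f t))"
proof -
  have "\<bar>sup_norm f - sup_norm g\<bar> \<le> norm (f - g)" for f g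
    using sup_norm_add[of "f - g" g] sup_norm_add[of "g - f" f] sup_norm_le_norm[of "f - g"]
      sup_norm_le_norm[of "g - f"] by (simp add: norm_minus_commute)
  then have "continuous_on UNIV sup_norm"
    unfolding continuous_on_iff dist_norm real_norm_def by (meson le_less_trans)
  then show ?thesis
    using continuous_on_compose2[OF _ assms] by blast
qed

section \<open>Relation to the almost-everywhere space\<close>

lemma inX_bdd: "inX (apply_bdd f)"
  using apply_bdd_le_norm[of f] by (auto simp: inX_def)

text \<open>The essential supremum lies between 0 and the supremum, so it is finite and
  \<open>real_of_ereal\<close> returns its true value. Convergence in \<open>norm\<close> therefore
  implies convergence in \<open>Xnorm\<close>.\<close>

lemma
  shows Xnorm_bdd_nonneg: "0 \<le> Xnorm (apply_bdd f)" and Xnorm_bdd_le: "Xnorm (apply_bdd f) \<le> norm f"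
proof -
  have le: "esssup lborel (\<lambda>x. ereal \<bar>f x\<bar>) \<le> ereal (sup_norm f)"
    by (rule esssup_I) (auto intro: sup_norm_upper)
  have "esssup lborel (\<lambda>x::real. 0::ereal) \<le> esssup lborel (\<lambda>x. ereal \<bar>f x\<bar>)"
    by (intro esssup_mono) auto
  then have ge: "0 \<le> esssup lborel (\<lambda>x. ereal \<bar>f x\<bar>)"
    by (subst (asm) esssup_const) auto
  have "0 \<le> Linfnorm f \<and> Linfnorm f \<le> sup_norm f"
    unfolding Linfnorm_def using le ge by (cases "esssup lborel (\<lambda>x. ereal \<bar>f x\<bar>)") auto
  then show "0 \<le> Xnorm (apply_bdd f)" "Xnorm (apply_bdd f) \<le> norm f"
    by (simp_all add: Xnorm_def L1norm_def norm_bdd_def l1_norm_def)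
qed

lemma inX_bdd_representative:
  assumes "inX f"
  obtains g where "AE x in lborel. apply_bdd g x = f x"
proof -
  obtain B where B: "AE x in lborel. \<bar>f x\<bar> \<le> B" and [measurable]: "f \<in> borel_measurable borel"
    and f: "integrable lborel f"
    using assms by (auto simp: inX_def)
  define g where "g = (\<lambda>x. if \<bar>f x\<bar> \<le> B then f x else 0)"
  have [measurable]: "g \<in> borel_measurable borel"
    unfolding g_def by measurable
  have ae: "AE x in lborel. f x = g x"
    using B by eventually_elim (simp add: g_def)
  then have "integrable lborel g"
    using f by (subst integrable_cong_AE[of g _ f]) auto
  then have "apply_bdd (Bdd g) = g"
    \<comment> \<open>The absolute value around \<open>B\<close> covers the branch where
      \<open>g\<close> is 0 without a proof that \<open>B\<close> is nonnegative.\<close>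
    by (intro Bdd_apply[of g "\<bar>B\<bar>"]) (auto simp: g_def)
  then show ?thesis
    using ae by (intro that[of "Bdd g"]) auto
qed

section \<open>Differential equations in Banach spaces\<close>

lemma at_within_atLeastAtMost_eq:
  fixes t :: real
  assumes "a \<le> t" "t < T"
  shows "at t within {a..T} = at t within {a..}"
  by (rule at_within_nhd[of _ "{..<T}"]) (use assms in auto)

lemma continuous_on_atLeast_iff:
  fixes f :: "real \<Rightarrow> 'a::topological_space"
  shows "continuous_on {a..} f \<longleftrightarrow> (\<forall>T. continuous_on {a..T} f)"
proof
  assume *: "\<forall>T. continuous_on {a..T} f"
  have "continuous (at t within {a..}) f" if "a \<le> t" for t
  proof -
    have "continuous (at t within {a..t + 1}) f"
      using *[rule_format, of "t + 1"] that by (simp add: continuous_on_eq_continuous_within)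
    then show ?thesis
      using at_within_atLeastAtMost_eq[OF that, of "t + 1"] by simp
  qed
  then show "continuous_on {a..} f"
    by (auto simp: continuous_on_eq_continuous_within)
qed (auto intro: continuous_on_subset)

lemma integral_has_vector_derivative_atLeast:
  fixes g :: "real \<Rightarrow> 'a::banach"
  assumes "continuous_on {0..} g" "0 \<le> t"
  shows "((\<lambda>u. integral {0..u} g) has_vector_derivative g t) (at t within {0..})"
  using integral_has_vector_derivative[of 0 "t + 1" g t] assms
    at_within_atLeastAtMost_eq[of 0 t "t + 1"] continuous_on_subset[of "{0..}" g "{0..t+1}"]
  by auto

lemma continuous_on_integral_atLeast:
  fixes g :: "real \<Rightarrow> 'a::banach"
  assumes "continuous_on {0..} g"
  shows "continuous_on {0..} (\<lambda>u. integral {0..u} g)"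
  unfolding continuous_on_eq_continuous_within
  using has_vector_derivative_continuous[OF integral_has_vector_derivative_atLeast[OF assms]] by auto

text \<open>The increment splits into \<open>f s (z s) - f s (z t)\<close>, small by the Lipschitz
  bound and continuity of \<open>z\<close>, and \<open>f s (z t) - f t (z t)\<close>, small by
  continuity in time with the state frozen.\<close>

lemma continuous_on_Lipschitz_compose:
  fixes f :: "real \<Rightarrow> 'a::real_normed_vector \<Rightarrow> 'a"
  assumes cont: "\<And>z. continuous_on {0..} (\<lambda>t. f t z)"
    and lip: "\<And>T. \<exists>L. \<forall>t\<in>{0..T}. \<forall>y z. norm (f t y - f t z) \<le> L * norm (y - z)"
    and z: "continuous_on {0..} z"
  shows "continuous_on {0..} (\<lambda>t. f t (z t))"
proof (unfold continuous_on, intro ballI)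
  fix t :: real assume t: "t \<in> {0..}"
  obtain L where L: "\<And>s y z. s \<in> {0..t+1} \<Longrightarrow> norm (f s y - f s z) \<le> L * norm (y - z)"
    using lip[of "t + 1"] by blast
  have "((\<lambda>s. f s (z s) - f s (z t)) \<longlongrightarrow> 0) (at t within {0..})"
  proof (rule Lim_null_comparison)
    have "\<forall>\<^sub>F s in at t within {0..}. s \<in> {0..t+1}"
      unfolding eventually_at by (intro exI[of _ 1]) (auto simp: dist_real_def)
    then show "\<forall>\<^sub>F s in at t within {0..}. norm (f s (z s) - f s (z t)) \<le> L * norm (z s - z t)"
      by eventually_elim (rule L)
    have "((\<lambda>s. z s - z t) \<longlongrightarrow> 0) (at t within {0..})"
      using z t by (auto simp: continuous_on intro!: LIM_zero)
    then show "((\<lambda>s. L * norm (z s - z t)) \<longlongrightarrow> 0) (at t within {0..})"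
      by (intro tendsto_mult_right_zero tendsto_norm_zero)
  qed
  moreover have "((\<lambda>s. f s (z t)) \<longlongrightarrow> f t (z t)) (at t within {0..})"
    using cont t by (auto simp: continuous_on)
  ultimately show "((\<lambda>s. f s (z s)) \<longlongrightarrow> f t (z t)) (at t within {0..})"
    using tendsto_add by fastforce
qed

text \<open>Picard iteration. On \<open>[0, T]\<close> the Lipschitz constant holds for all states,
  so successive iterates differ by at most \<open>C * (L * t) ^ n / fact n\<close>. This is summable
  for every \<open>T\<close>, and no smallness of the interval is required.\<close>

theorem Lipschitz_ode_global_solution:
  fixes f :: "real \<Rightarrow> 'a::banach \<Rightarrow> 'a"
  assumes cont: "\<And>z. continuous_on {0..} (\<lambda>t. f t z)"
    and lip: "\<And>T. \<exists>L. \<forall>t\<in>{0..T}. \<forall>y z. norm (f t y - f t z) \<le> L * norm (y - z)"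
  obtains z where "z 0 = z0"
    and "\<And>t. 0 \<le> t \<Longrightarrow> (z has_vector_derivative f t (z t)) (at t within {0..})"
proof -
  note fz = continuous_on_Lipschitz_compose[of f, OF cont lip]
  define P where "P = rec_nat (\<lambda>_. z0) (\<lambda>_ p t. z0 + integral {0..t} (\<lambda>s. f s (p s)))"
  have P0: "P 0 = (\<lambda>_. z0)" and PS: "\<And>n. P (Suc n) = (\<lambda>t. z0 + integral {0..t} (\<lambda>s. f s (P n s)))"
    by (simp_all add: P_def)
  have Pc: "continuous_on {0..} (P n)" for n
    by (induction n) (auto simp: P0 PS intro!: continuous_intros continuous_on_integral_atLeast fz)
  have int: "(\<lambda>s. f s (z s)) integrable_on {0..t}" if "continuous_on {0..} z" for z t
    using fz[OF that] by (intro integrable_continuous_real) (auto elim: continuous_on_subset)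
  \<comment> \<open>The telescoping series defines one function on the whole half-line, which is
    then the uniform limit of the iterates on each \<open>[0, T]\<close>.\<close>
  define z where "z t = z0 + (\<Sum>n. P (Suc n) t - P n t)" for t
  have lim: "uniform_limit {0..T} P z sequentially" for T
  proof -
    obtain L' where L': "\<And>s y z. s \<in> {0..T} \<Longrightarrow> norm (f s y - f s z) \<le> L' * norm (y - z)"
      using lip[of T] by blast
    define L where "L = max L' 0"
    have L: "0 \<le> L" "\<And>s y z. s \<in> {0..T} \<Longrightarrow> norm (f s y - f s z) \<le> L * norm (y - z)"
      unfolding L_def using order_trans[OF L' mult_right_mono] by auto
    have "bounded ((\<lambda>t. P (Suc 0) t - P 0 t) ` {0..T})"
      by (intro compact_imp_bounded compact_continuous_image continuous_on_diff)
        (auto intro: continuous_on_subset[OF Pc])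
    then obtain C where "0 < C" "\<forall>d\<in>(\<lambda>t. P (Suc 0) t - P 0 t) ` {0..T}. norm d \<le> C"
      unfolding bounded_pos by blast
    then have C: "0 \<le> C" "\<And>t. t \<in> {0..T} \<Longrightarrow> norm (P (Suc 0) t - P 0 t) \<le> C"
      by auto
    have bound: "\<forall>t\<in>{0..T}. norm (P (Suc n) t - P n t) \<le> C * (L * t) ^ n / fact n" for n
    proof (induction n)
      case (Suc n)
      show ?case
      proof
        fix t assume t: "t \<in> {0..T}"
        let ?q = "\<lambda>s. C * (L * s) ^ Suc n / fact (Suc n)"
        have "(?q has_real_derivative L * (C * (L * s) ^ n / fact n)) (at s within {0..t})" for s
        proof -
          have "((\<lambda>s. (L * s) ^ Suc n) has_real_derivative real (Suc n) * ((L * s) ^ n * L)) (at s within {0..t})"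
            using DERIV_power_Suc[OF DERIV_cmult_Id[of L s "{0..t}"], of n]
            by (simp del: power_Suc add: mult_ac)
          from DERIV_cdivide[OF DERIV_cmult[OF this, of C], of "fact (Suc n)"]
          show ?thesis
            by (rule DERIV_cong) (simp add: field_simps del: of_nat_Suc power_Suc)
        qed
        then have "(?q has_vector_derivative L * (C * (L * s) ^ n / fact n)) (at s within {0..t})" for s
          unfolding has_real_derivative_iff_has_vector_derivative[symmetric] .
        then have q: "((\<lambda>s. L * (C * (L * s) ^ n / fact n)) has_integral (?q t - ?q 0)) {0..t}"
          using t by (intro fundamental_theorem_of_calculus) auto
        have "P (Suc (Suc n)) t - P (Suc n) t
            = integral {0..t} (\<lambda>s. f s (P (Suc n) s) - f s (P n s))"
          unfolding PS[of "Suc n"] PS[THEN fun_cong, of n t]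
          by (simp add: Henstock_Kurzweil_Integration.integral_diff int Pc)
        also have "norm \<dots> \<le> integral {0..t} (\<lambda>s. L * (C * (L * s) ^ n / fact n))"
        proof (rule Henstock_Kurzweil_Integration.integral_norm_bound_integral)
          show "(\<lambda>s. f s (P (Suc n) s) - f s (P n s)) integrable_on {0..t}"
            by (intro integrable_diff int Pc)
          show "norm (f s (P (Suc n) s) - f s (P n s)) \<le> L * (C * (L * s) ^ n / fact n)"
            if "s \<in> {0..t}" for s
          proof -
            have s: "s \<in> {0..T}" using that t by auto
            show ?thesis
              using order_trans[OF L(2)[OF s] mult_left_mono[OF Suc.IH[rule_format, OF s] L(1)]] .
          qed
        qed (rule has_integral_integrable[OF q])
        also have "\<dots> = ?q t"
          using integral_unique[OF q] by simp
        finally show "norm (P (Suc (Suc n)) t - P (Suc n) t) \<le> ?q t" .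
      qed
    qed (use C in auto)
    have "uniform_limit {0..T} (\<lambda>n t. \<Sum>i<n. P (Suc i) t - P i t)
        (\<lambda>t. \<Sum>i. P (Suc i) t - P i t) sequentially"
    proof (rule Weierstrass_m_test)
      fix n t assume t: "t \<in> {0..T}"
      have "norm (P (Suc n) t - P n t) \<le> C * (L * t) ^ n / fact n"
        using bound t by blast
      also have "\<dots> \<le> C * (L * T) ^ n / fact n"
        using t L(1) C(1) by (intro divide_right_mono mult_left_mono power_mono) auto
      finally show "norm (P (Suc n) t - P n t) \<le> C * (inverse (fact n) * (L * T) ^ n)"
        by (simp add: field_simps)
    next
      show "summable (\<lambda>n. C * (inverse (fact n) * (L * T) ^ n))"
        by (intro summable_mult summable_exp)
    qed
    then have "uniform_limit {0..T} (\<lambda>n t. z0 + (\<Sum>i<n. P (Suc i) t - P i t)) z sequentially"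
      unfolding z_def by (intro uniform_limit_add uniform_limit_const)
    moreover have "z0 + (\<Sum>i<n. P (Suc i) t - P i t) = P n t" for n t
      using sum_lessThan_telescope[of "\<lambda>i. P i t" n] by (simp add: P0)
    ultimately show ?thesis
      by simp
  qed
  have zc: "continuous_on {0..} z"
    unfolding continuous_on_atLeast_iff
  proof
    show "continuous_on {0..T} z" for T
      by (rule uniform_limit_theorem[OF _ lim])
        (auto intro!: always_eventually continuous_on_subset[OF Pc])
  qed
  have z: "z t = z0 + integral {0..t} (\<lambda>s. f s (z s))" if t: "0 \<le> t" for t
  proof (rule LIMSEQ_unique)
    show "(\<lambda>n. P (Suc n) t) \<longlonglongrightarrow> z t"
      by (rule LIMSEQ_Suc[OF tendsto_uniform_limitI[OF lim[of t]]]) (use t in auto)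
    obtain L where L: "\<And>s y z. s \<in> {0..t} \<Longrightarrow> norm (f s y - f s z) \<le> L * norm (y - z)"
      using lip[of t] by blast
    \<comment> \<open>Uniform convergence of the integrands allows the limit to pass through the
      integral in the recursion for \<open>P\<close>.\<close>
    have "uniform_limit {0..t} (\<lambda>n s. f s (P n s)) (\<lambda>s. f s (z s)) sequentially"
    proof (rule uniform_limitI)
      fix e :: real assume e: "0 < e"
      \<comment> \<open>Adding 1 avoids division by zero and makes \<open>\<bar>L\<bar> * d\<close>
        strictly smaller than \<open>e\<close>.\<close>
      define d where "d = e / (\<bar>L\<bar> + 1)"
      have d: "0 < d" using e by (simp add: d_def)
      show "\<forall>\<^sub>F n in sequentially. \<forall>s\<in>{0..t}. dist (f s (P n s)) (f s (z s)) < e"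
        using uniform_limitD[OF lim[of t] d]
      proof eventually_elim
        case (elim n)
        show ?case
        proof
          fix s assume s: "s \<in> {0..t}"
          have "norm (f s (P n s) - f s (z s)) \<le> L * norm (P n s - z s)"
            by (rule L[OF s])
          also have "\<dots> \<le> \<bar>L\<bar> * d"
            using elim s by (intro mult_mono) (auto simp: dist_norm less_imp_le)
          also have "\<dots> < e"
            using e by (simp add: d_def field_simps)
          finally show "dist (f s (P n s)) (f s (z s)) < e"
            by (simp add: dist_norm)
        qed
      qed
    qed
    then obtain I J where I: "\<And>n. ((\<lambda>s. f s (P n s)) has_integral I n) {0..t}"
      and J: "((\<lambda>s. f s (z s)) has_integral J) {0..t}" and lim_I: "I \<longlonglongrightarrow> J"
      by (rule uniform_limit_integral) (auto intro: continuous_on_subset[OF fz[OF Pc]])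
    have "(\<lambda>n. integral {0..t} (\<lambda>s. f s (P n s))) = I"
      using I by (intro ext integral_unique)
    then have "(\<lambda>n. integral {0..t} (\<lambda>s. f s (P n s))) \<longlonglongrightarrow> integral {0..t} (\<lambda>s. f s (z s))"
      using lim_I integral_unique[OF J] by simp
    then show "(\<lambda>n. P (Suc n) t) \<longlonglongrightarrow> z0 + integral {0..t} (\<lambda>s. f s (z s))"
      unfolding PS by (intro tendsto_intros)
  qed
  show ?thesis
  proof
    show "z 0 = z0" using z[of 0] by simp
    fix t :: real assume t: "0 \<le> t"
    have "((\<lambda>t. z0 + integral {0..t} (\<lambda>s. f s (z s))) has_vector_derivative f t (z t)) (at t within {0..})"
      using has_vector_derivative_add[OF has_vector_derivative_const
          integral_has_vector_derivative_atLeast[OF fz[OF zc] t]] by simp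
    then show "(z has_vector_derivative f t (z t)) (at t within {0..})"
      by (rule has_vector_derivative_transform[rotated 2]) (use t z in auto)
  qed
qed

text \<open>If \<open>d\<close> reached 0, there would be a first zero \<open>m\<close>. Up to
  \<open>m\<close> the function is nonpositive by the intermediate value theorem, so
  \<open>step\<close> gives \<open>d m < 0\<close>, a contradiction.\<close>

lemma negative_by_bootstrap:
  fixes d :: "real \<Rightarrow> real"
  assumes cont: "continuous_on {0..} d"
    and step: "\<And>t. 0 \<le> t \<Longrightarrow> (\<And>s. 0 \<le> s \<Longrightarrow> s \<le> t \<Longrightarrow> d s \<le> 0) \<Longrightarrow> d t < 0"
    and init: "d 0 < 0" and t: "0 \<le> t"
  shows "d t < 0"
proof (rule ccontr)
  assume "\<not> d t < 0"
  define S where "S = {s \<in> {0..t}. d s = 0}"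
  have zero: "\<exists>r\<in>{0..s}. d r = 0" if "0 \<le> s" "0 \<le> d s" for s
  proof -
    have "\<exists>r\<ge>0. r \<le> s \<and> d r = 0"
      using init that by (intro IVT') (auto intro: continuous_on_subset[OF cont])
    then show ?thesis by auto
  qed
  have "closed S"
    unfolding S_def by (intro continuous_closed_preimage_constant) (auto intro: continuous_on_subset[OF cont])
  moreover have "bounded S"
    by (rule bounded_subset[OF bounded_closed_interval[of 0 t]]) (auto simp: S_def)
  ultimately have "compact S"
    by (simp add: compact_eq_bounded_closed)
  have "S \<noteq> {}"
    using zero[of t] t \<open>\<not> d t < 0\<close> by (auto simp: S_def)
  with \<open>compact S\<close> obtain m where m: "m \<in> S" "\<forall>s\<in>S. m \<le> s"
    using compact_attains_inf[of S] by blast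
  have "d s \<le> 0" if "0 \<le> s" "s \<le> m" for s
  proof (rule ccontr)
    assume "\<not> d s \<le> 0"
    then obtain r where "0 \<le> r" "r \<le> s" "d r = 0" using zero[of s] \<open>0 \<le> s\<close> by auto
    then have "m \<le> r"
      using m that by (auto simp: S_def)
    then have "r = s"
      using \<open>r \<le> s\<close> \<open>s \<le> m\<close> by linarith
    then show False
      using \<open>d r = 0\<close> \<open>\<not> d s \<le> 0\<close> by simp
  qed
  moreover have "0 \<le> m"
    using m(1) by (simp add: S_def)
  ultimately have "d m < 0"
    using step by blast
  then show False
    using m(1) by (simp add: S_def)
qed

section \<open>Nonlocal operators\<close>

text \<open>The conditions on the kernel hold at every point: \<open>al\<close> is to be a
  representative of the given kernel, corrected on a null set.\<close>

locale kernel =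
  fixes al :: "real \<Rightarrow> real" and A :: real
  assumes al_measurable [measurable]: "al \<in> borel_measurable borel"
    and al_integrable: "integrable lborel al"
    and al_nonneg: "0 \<le> al x" and al_le: "al x \<le> A" and al_even: "al (- x) = al x"
begin

definition mass :: real where "mass = (\<integral>x. al x \<partial>lborel)"

lemma mass_nonneg: "0 \<le> mass"
  by (simp add: mass_def al_nonneg)

lemma al_sym: "al (x - y) = al (y - x)"
  using al_even[of "x - y"] by simp

lemma shift_integrable: "integrable lborel (\<lambda>y. al (y - x))"
  using lborel_integrable_real_affine[OF al_integrable, of 1 "- x"] by (simp add: add.commute)

lemma shift_integral: "(\<integral>y. al (y - x) \<partial>lborel) = mass"
  using lborel_integral_real_affine[of 1 al "- x"] by (simp add: add.commute mass_def)

lemma integrable_fst_weight: "integrable (lborel \<Otimes>\<^sub>M lborel) (\<lambda>(x, y). al (y - x) * \<bar>apply_bdd f x\<bar>)"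
proof (rule lborel_pair.Fubini_integrable)
  show "integrable lborel (\<lambda>x. \<integral>y. norm (case (x, y) of (x, y) \<Rightarrow> al (y - x) * \<bar>f x\<bar>) \<partial>lborel)"
    by (simp add: al_nonneg abs_mult shift_integral)
qed (auto intro!: shift_integrable)

text \<open>Swapping the variables reduces this to \<open>integrable_fst_weight\<close>, because the
  kernel is even.\<close>

lemma integrable_snd_weight: "integrable (lborel \<Otimes>\<^sub>M lborel) (\<lambda>(x, y). al (y - x) * \<bar>apply_bdd f y\<bar>)"
  using lborel_pair.integrable_product_swap[OF integrable_fst_weight[of f]]
  by (simp add: case_prod_unfold al_sym)

text \<open>Weighted by \<open>al (y - x)\<close>, the dominating function is integrable over the
  plane and has uniformly bounded slice integrals. A single condition thus yields both parts of the
  norm, and \<open>norm f\<close> measures the size of the resulting operator.\<close>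

definition controlled :: "bdd \<Rightarrow> (real \<Rightarrow> real \<Rightarrow> real) \<Rightarrow> bool" where
  "controlled f G \<longleftrightarrow> (\<lambda>p. G (fst p) (snd p)) \<in> borel_measurable (borel \<Otimes>\<^sub>M borel)
     \<and> (\<forall>x y. \<bar>G x y\<bar> \<le> \<bar>f x\<bar> + \<bar>f y\<bar>)"

definition kint :: "(real \<Rightarrow> real \<Rightarrow> real) \<Rightarrow> bdd" where
  "kint G = Bdd (\<lambda>x. \<integral>y. al (y - x) * G x y \<partial>lborel)"

context
  fixes f G
  assumes G: "controlled f G"
begin

lemma controlled_measurable [measurable]: "(\<lambda>p. G (fst p) (snd p)) \<in> borel_measurable (borel \<Otimes>\<^sub>M borel)"
  and controlled_le: "\<bar>G x y\<bar> \<le> \<bar>f x\<bar> + \<bar>f y\<bar>"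
  using G by (auto simp: controlled_def)

lemma slice_measurable [measurable]: "G x \<in> borel_measurable borel"
  using measurable_compose[OF measurable_Pair1' controlled_measurable, of x] by simp

lemma weighted_le: "\<bar>al (y - x) * G x y\<bar> \<le> al (y - x) * \<bar>f x\<bar> + al (y - x) * \<bar>f y\<bar>"
  using mult_left_mono[OF controlled_le al_nonneg] by (simp add: abs_mult al_nonneg distrib_left)

lemma weighted_le_sup: "\<bar>al (y - x) * G x y\<bar> \<le> al (y - x) * (2 * sup_norm f)"
proof -
  have "\<bar>G x y\<bar> \<le> 2 * sup_norm f"
    using controlled_le[of x y] sup_norm_upper[of f x] sup_norm_upper[of f y] by linarith
  then show ?thesis
    by (simp add: abs_mult al_nonneg mult_left_mono)
qed

lemma slice_integrable: "integrable lborel (\<lambda>y. al (y - x) * G x y)"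
  by (rule Bochner_Integration.integrable_bound[of _ "\<lambda>y. al (y - x) * (2 * sup_norm f)"])
    (use weighted_le_sup in \<open>auto intro!: shift_integrable intro: order_trans[OF _ abs_ge_self]\<close>)

lemma weighted_measurable [measurable]:
  "(\<lambda>(x, y). al (y - x) * G x y) \<in> borel_measurable (borel \<Otimes>\<^sub>M borel)"
  by (simp add: case_prod_unfold)

lemma product_integrable: "integrable (lborel \<Otimes>\<^sub>M lborel) (\<lambda>(x, y). al (y - x) * G x y)"
proof (rule Bochner_Integration.integrable_bound)
  show "integrable (lborel \<Otimes>\<^sub>M lborel)
      (\<lambda>p. (case p of (x, y) \<Rightarrow> al (y - x) * \<bar>f x\<bar>) + (case p of (x, y) \<Rightarrow> al (y - x) * \<bar>f y\<bar>))"
    by (intro Bochner_Integration.integrable_add integrable_fst_weight integrable_snd_weight)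
  show "(\<lambda>(x, y). al (y - x) * G x y) \<in> borel_measurable (lborel \<Otimes>\<^sub>M lborel)"
    by measurable
qed (rule AE_I2, use weighted_le in \<open>auto intro: order_trans[OF _ abs_ge_self]\<close>)

text \<open>For the sup part, \<open>G\<close> is at most \<open>2 * sup_norm f\<close> and the
  kernel has total mass \<open>mass\<close>. For the integral part, each of the two dominating terms
  contributes \<open>mass * l1_norm f\<close>, the second one by Fubini.\<close>

lemma
  shows kint_apply: "apply_bdd (kint G) = (\<lambda>x. \<integral>y. al (y - x) * G x y \<partial>lborel)"
    and norm_kint_le: "norm (kint G) \<le> 2 * mass * norm f"
proof -
  let ?k = "\<lambda>x. \<integral>y. al (y - x) * G x y \<partial>lborel"
  have i: "integrable lborel ?k"
    using lborel_pair.integrable_fst'[OF product_integrable] by simp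
  have b: "\<bar>?k x\<bar> \<le> 2 * mass * sup_norm f" for x
  proof -
    have "\<bar>?k x\<bar> \<le> (\<integral>y. al (y - x) * (2 * sup_norm f) \<partial>lborel)"
      by (intro order_trans[OF integral_abs_bound] integral_mono)
        (auto intro!: slice_integrable shift_integrable weighted_le_sup)
    then show ?thesis
      by (simp add: shift_integral mult_ac)
  qed
  show app: "apply_bdd (kint G) = ?k"
    unfolding kint_def using i b by (intro Bdd_apply) auto
  have f1: "integrable lborel (\<lambda>x. mass * \<bar>f x\<bar>)"
    by auto
  have f2: "integrable lborel (\<lambda>x. \<integral>y. al (y - x) * \<bar>f y\<bar> \<partial>lborel)"
    using lborel_pair.integrable_fst'[OF integrable_snd_weight] by simp
  have s: "integrable lborel (\<lambda>y. al (y - x) * \<bar>f y\<bar>)" for x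
    by (rule Bochner_Integration.integrable_bound[of _ "\<lambda>y. al (y - x) * sup_norm f"])
      (auto intro!: shift_integrable simp: abs_mult al_nonneg mult_left_mono sup_norm_upper)
  have "(\<integral>x. \<bar>?k x\<bar> \<partial>lborel) \<le> (\<integral>x. mass * \<bar>f x\<bar> + (\<integral>y. al (y - x) * \<bar>f y\<bar> \<partial>lborel) \<partial>lborel)"
  proof (intro integral_mono)
    fix x
    have "\<bar>?k x\<bar> \<le> (\<integral>y. al (y - x) * \<bar>f x\<bar> + al (y - x) * \<bar>f y\<bar> \<partial>lborel)"
      by (intro order_trans[OF integral_abs_bound] integral_mono)
        (auto intro!: slice_integrable shift_integrable weighted_le s)
    also have "\<dots> = mass * \<bar>f x\<bar> + (\<integral>y. al (y - x) * \<bar>f y\<bar> \<partial>lborel)"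
      by (subst Bochner_Integration.integral_add) (auto intro!: shift_integrable s simp: shift_integral)
    finally show "\<bar>?k x\<bar> \<le> \<dots>" .
  qed (use i f1 f2 in auto)
  also have "\<dots> = mass * l1_norm f + (\<integral>x. \<integral>y. al (y - x) * \<bar>f y\<bar> \<partial>lborel \<partial>lborel)"
    using f1 f2 by (subst Bochner_Integration.integral_add) (auto simp: l1_norm_def)
  also have "(\<integral>x. \<integral>y. al (y - x) * \<bar>f y\<bar> \<partial>lborel \<partial>lborel) = (\<integral>y. \<integral>x. al (y - x) * \<bar>f y\<bar> \<partial>lborel \<partial>lborel)"
    using lborel_pair.Fubini_integral[of "\<lambda>x y. al (y - x) * \<bar>f y\<bar>"] integrable_snd_weight by simp
  also have "\<dots> = mass * l1_norm f"
    by (subst al_sym) (simp add: shift_integral l1_norm_def)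
  finally have "norm (kint G) \<le> 2 * mass * sup_norm f + (mass * l1_norm f + mass * l1_norm f)"
    using b by (intro norm_bdd_leI) (simp_all add: app)
  then show "norm (kint G) \<le> 2 * mass * norm f"
    by (simp add: norm_bdd_def algebra_simps)
qed

text \<open>Fubini together with evenness of the kernel. Combined with oddness of \<open>w\<close>,
  this symmetry is the source of energy conservation.\<close>

lemma integral_kint_swap:
  "(\<integral>x. kint G x \<partial>lborel) = (\<integral>x. kint (\<lambda>x y. G y x) x \<partial>lborel)"
proof -
  have "controlled f (\<lambda>x y. G y x)"
    unfolding controlled_def
  proof (intro conjI allI)
    show "(\<lambda>p. G (snd p) (fst p)) \<in> borel_measurable (borel \<Otimes>\<^sub>M borel)"
      using measurable_compose[OF measurable_Pair[OF measurable_snd measurable_fst] controlled_measurable] by simp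
    show "\<bar>G y x\<bar> \<le> \<bar>f x\<bar> + \<bar>f y\<bar>" for x y
      using controlled_le[of y x] by simp
  qed
  then show ?thesis
    using lborel_pair.Fubini_integral[of "\<lambda>x y. al (y - x) * G x y"] product_integrable
    by (simp add: kint_apply kernel.kint_apply[OF kernel_axioms] al_sym)
qed

end

lemma kint_diff:
  assumes G: "controlled f G" and H: "controlled g H" and GH: "controlled h (\<lambda>x y. G x y - H x y)"
  shows "kint (\<lambda>x y. G x y - H x y) = kint G - kint H"
  by (intro bdd_eqI)
    (simp add: kint_apply[OF G] kint_apply[OF H] kint_apply[OF GH] right_diff_distrib
      slice_integrable[OF G] slice_integrable[OF H])

lemma kint_add:
  assumes G: "controlled f G" and H: "controlled g H" and GH: "controlled h (\<lambda>x y. G x y + H x y)"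
  shows "kint (\<lambda>x y. G x y + H x y) = kint G + kint H"
  by (intro bdd_eqI)
    (simp add: kint_apply[OF G] kint_apply[OF H] kint_apply[OF GH] distrib_left
      slice_integrable[OF G] slice_integrable[OF H])

lemma kint_scaleR:
  assumes G: "controlled f G" and cG: "controlled h (\<lambda>x y. c * G x y)"
  shows "kint (\<lambda>x y. c * G x y) = c *\<^sub>R kint G"
  by (intro bdd_eqI) (simp add: kint_apply[OF G] kint_apply[OF cG] mult.left_commute[of _ c])

lemma controlled_uminus: "controlled f G \<Longrightarrow> controlled f (\<lambda>x y. - G x y)"
  unfolding controlled_def by (auto intro: borel_measurable_uminus)

lemma kint_uminus:
  assumes G: "controlled f G"
  shows "kint (\<lambda>x y. - G x y) = - kint G"
  by (intro bdd_eqI) (simp add: kint_apply[OF G] kint_apply[OF controlled_uminus[OF G]])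

definition diff_op :: "(real \<Rightarrow> real) \<Rightarrow> bdd \<Rightarrow> bdd" where
  "diff_op g u = kint (\<lambda>x y. g (u y - u x))"

lemma diff_bound: "\<bar>apply_bdd u y - apply_bdd u x\<bar> \<le> 2 * sup_norm u"
  using sup_norm_upper[of u x] sup_norm_upper[of u y] by linarith

text \<open>Differences of values of \<open>u\<close> never exceed \<open>2 * sup_norm u\<close>, so
  a linear bound on that range suffices and the operators are defined for \<open>w\<close> and
  \<open>W\<close> themselves, whatever their growth.\<close>

lemma controlled_diff_op:
  assumes [measurable]: "g \<in> borel_measurable borel"
    and le: "\<And>s. \<bar>s\<bar> \<le> 2 * sup_norm u \<Longrightarrow> \<bar>g s\<bar> \<le> L * \<bar>s\<bar>"
  shows "controlled (\<bar>L\<bar> *\<^sub>R u) (\<lambda>x y. g (u y - u x))"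
  unfolding controlled_def
proof (intro conjI allI)
  fix x y
  have "\<bar>g (u y - u x)\<bar> \<le> L * \<bar>u y - u x\<bar>"
    by (rule le[OF diff_bound])
  also have "\<dots> \<le> \<bar>L\<bar> * (\<bar>u x\<bar> + \<bar>u y\<bar>)"
    by (intro mult_mono) auto
  finally show "\<bar>g (u y - u x)\<bar> \<le> \<bar>(\<bar>L\<bar> *\<^sub>R u) x\<bar> + \<bar>(\<bar>L\<bar> *\<^sub>R u) y\<bar>"
    by (simp add: abs_mult distrib_left)
qed measurable

lemma controlled_scaled:
  fixes h :: bdd
  assumes [measurable]: "(\<lambda>p. G (fst p) (snd p)) \<in> borel_measurable (borel \<Otimes>\<^sub>M borel)"
    and le: "\<And>x y. \<bar>G x y\<bar> \<le> L * \<bar>h y - h x\<bar>"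
  shows "controlled (\<bar>L\<bar> *\<^sub>R h) G"
  unfolding controlled_def
proof (intro conjI allI)
  fix x y
  have "L * \<bar>h y - h x\<bar> \<le> \<bar>L\<bar> * (\<bar>h x\<bar> + \<bar>h y\<bar>)"
    by (intro mult_mono) auto
  then show "\<bar>G x y\<bar> \<le> \<bar>(\<bar>L\<bar> *\<^sub>R h) x\<bar> + \<bar>(\<bar>L\<bar> *\<^sub>R h) y\<bar>"
    using le[of x y] by (simp add: abs_mult distrib_left)
qed measurable

text \<open>The difference of the two integrands is controlled by a multiple of
  \<open>u - v\<close>, so \<open>norm_kint_le\<close> yields the Lipschitz constant.\<close>

lemma diff_op_Lipschitz:
  assumes [measurable]: "g \<in> borel_measurable borel" and g0: "g 0 = 0"
    and lip: "\<And>s t. \<bar>g s - g t\<bar> \<le> L * \<bar>s - t\<bar>"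
  shows "norm (diff_op g u - diff_op g v) \<le> 2 * mass * \<bar>L\<bar> * norm (u - v)"
proof -
  have le: "\<bar>g s\<bar> \<le> L * \<bar>s\<bar>" for s
    using lip[of s 0] g0 by simp
  have c: "controlled (\<bar>L\<bar> *\<^sub>R (u - v)) (\<lambda>x y. g (u y - u x) - g (v y - v x))"
  proof (rule controlled_scaled)
    show "\<bar>g (u y - u x) - g (v y - v x)\<bar> \<le> L * \<bar>(u - v) y - (u - v) x\<bar>" for x y
      using lip[of "u y - u x" "v y - v x"] by (simp add: algebra_simps)
  qed measurable
  have "kint (\<lambda>x y. g (u y - u x) - g (v y - v x)) = diff_op g u - diff_op g v"
    unfolding diff_op_def by (intro kint_diff[OF controlled_diff_op[where L = L] controlled_diff_op[where L = L] c] le) simp_all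
  then show ?thesis
    using norm_kint_le[OF c] by (simp add: mult.assoc)
qed

lemma diff_op_coefficient:
  assumes [measurable]: "g \<in> borel_measurable borel" "h \<in> borel_measurable borel"
    and g: "\<And>s. \<bar>g s\<bar> \<le> M * \<bar>s\<bar>" and h: "\<And>s. \<bar>h s\<bar> \<le> M * \<bar>s\<bar>"
    and gh: "\<And>s. \<bar>g s - h s\<bar> \<le> L * \<bar>s\<bar>"
  shows "norm (diff_op g u - diff_op h u) \<le> 2 * mass * \<bar>L\<bar> * norm u"
proof -
  have c: "controlled (\<bar>L\<bar> *\<^sub>R u) (\<lambda>x y. g (u y - u x) - h (u y - u x))"
    by (rule controlled_diff_op[of "\<lambda>s. g s - h s"]) (use gh in auto)
  have "kint (\<lambda>x y. g (u y - u x) - h (u y - u x)) = diff_op g u - diff_op h u"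
    unfolding diff_op_def by (intro kint_diff[OF controlled_diff_op[where L = M] controlled_diff_op[where L = M] c] g h) simp_all
  then show ?thesis
    using norm_kint_le[OF c] by (simp add: mult.assoc)
qed

end

section \<open>Potentials with locally Lipschitz derivative\<close>

lemma derivative_bound_segment:
  fixes W w :: "real \<Rightarrow> real"
  assumes "\<And>s. (W has_real_derivative w s) (at s)" "\<And>s. s \<in> closed_segment a b \<Longrightarrow> \<bar>w s\<bar> \<le> M"
  shows "\<bar>W b - W a\<bar> \<le> M * \<bar>b - a\<bar>"
  using field_differentiable_bound[of "closed_segment a b" W w M b a] assms
  by (auto intro: DERIV_subset simp: has_field_derivative_at_within)

locale potential =
  fixes w W :: "real \<Rightarrow> real"
  assumes W_deriv: "(W has_real_derivative w s) (at s)"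
    and W_0: "W 0 = 0" and w_odd: "w (- s) = - w s"
    and w_local_Lipschitz: "\<exists>L\<ge>0. \<forall>a b. \<bar>a\<bar> \<le> r \<longrightarrow> \<bar>b\<bar> \<le> r \<longrightarrow> \<bar>w a - w b\<bar> \<le> L * \<bar>a - b\<bar>"
begin

lemma w_0: "w 0 = 0"
  using w_odd[of 0] by simp

lemma w_bound:
  "\<exists>M. \<forall>s. \<bar>s\<bar> \<le> r \<longrightarrow> \<bar>w s\<bar> \<le> M * \<bar>s\<bar> \<and> \<bar>w s\<bar> \<le> M"
proof -
  obtain L where L: "0 \<le> L" "\<And>a b. \<bar>a\<bar> \<le> r \<Longrightarrow> \<bar>b\<bar> \<le> r \<Longrightarrow> \<bar>w a - w b\<bar> \<le> L * \<bar>a - b\<bar>"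
    using w_local_Lipschitz[of r] by blast
  have le: "\<bar>w s\<bar> \<le> L * \<bar>s\<bar>" if "\<bar>s\<bar> \<le> r" for s
    using L(2)[of s 0] that w_0 by simp
  show ?thesis
  proof (intro exI allI impI conjI)
    fix s assume s: "\<bar>s\<bar> \<le> r"
    show "\<bar>w s\<bar> \<le> max L (L * r) * \<bar>s\<bar>"
      using le[OF s] by (rule order_trans) (intro mult_right_mono, auto)
    show "\<bar>w s\<bar> \<le> max L (L * r)"
      using le[OF s] mult_left_mono[OF s L(1)] by linarith
  qed
qed

lemma w_continuous: "continuous_on UNIV w"
proof (rule continuous_at_imp_continuous_on, rule ballI)
  fix x
  obtain L where L: "\<And>a b. \<bar>a\<bar> \<le> \<bar>x\<bar> + 1 \<Longrightarrow> \<bar>b\<bar> \<le> \<bar>x\<bar> + 1 \<Longrightarrow> \<bar>w a - w b\<bar> \<le> L * \<bar>a - b\<bar>"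
    using w_local_Lipschitz[of "\<bar>x\<bar> + 1"] by blast
  have "((\<lambda>y. w y - w x) \<longlongrightarrow> 0) (at x)"
  proof (rule Lim_null_comparison)
    have "\<forall>\<^sub>F y in at x. \<bar>y\<bar> \<le> \<bar>x\<bar> + 1"
      unfolding eventually_at by (intro exI[of _ 1]) (auto simp: dist_real_def)
    then show "\<forall>\<^sub>F y in at x. norm (w y - w x) \<le> L * \<bar>y - x\<bar>"
      by eventually_elim (use L in auto)
    show "((\<lambda>y. L * \<bar>y - x\<bar>) \<longlongrightarrow> 0) (at x)"
      by (auto intro!: tendsto_eq_intros)
  qed
  then show "isCont w x"
    unfolding isCont_def by (rule LIM_zero_cancel)
qed

lemma w_measurable [measurable]: "w \<in> borel_measurable borel"
  using w_continuous by (rule borel_measurable_continuous_onI)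

lemma W_measurable [measurable]: "W \<in> borel_measurable borel"
  by (intro borel_measurable_continuous_onI continuous_at_imp_continuous_on)
    (auto intro: DERIV_isCont W_deriv)

lemma W_bound:
  "\<exists>M. \<forall>s. \<bar>s\<bar> \<le> r \<longrightarrow> \<bar>W s\<bar> \<le> M * \<bar>s\<bar>"
proof -
  obtain M where M: "\<And>s. \<bar>s\<bar> \<le> r \<Longrightarrow> \<bar>w s\<bar> \<le> M"
    using w_bound[of r] by blast
  have "\<bar>W s\<bar> \<le> M * \<bar>s\<bar>" if s: "\<bar>s\<bar> \<le> r" for s
  proof -
    have "\<bar>x\<bar> \<le> r" if "x \<in> closed_segment 0 s" for x
      using that s by (auto simp: closed_segment_eq_real_ivl split: if_splits)
    then have "\<bar>w x\<bar> \<le> M" if "x \<in> closed_segment 0 s" for x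
      using M that by simp
    then have "\<bar>W s - W 0\<bar> \<le> M * \<bar>s - 0\<bar>"
      by (rule derivative_bound_segment[OF W_deriv])
    then show ?thesis by (simp add: W_0)
  qed
  then show ?thesis by blast
qed

text \<open>The mean value inequality for \<open>W s - w a * s\<close>, whose derivative
  \<open>w s - w a\<close> is at most \<open>L * \<bar>b\<bar>\<close> on the segment.\<close>

lemma W_remainder:
  assumes L: "\<And>a b. \<bar>a\<bar> \<le> r \<Longrightarrow> \<bar>b\<bar> \<le> r \<Longrightarrow> \<bar>w a - w b\<bar> \<le> L * \<bar>a - b\<bar>" and "0 \<le> L"
    and ab: "\<bar>a\<bar> \<le> r" "\<bar>a + b\<bar> \<le> r"
  shows "\<bar>W (a + b) - W a - w a * b\<bar> \<le> L * \<bar>b\<bar> * \<bar>b\<bar>"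
proof -
  have "\<bar>w s - w a\<bar> \<le> L * \<bar>b\<bar>" if s: "s \<in> closed_segment a (a + b)" for s
  proof -
    have s: "\<bar>s\<bar> \<le> r" "\<bar>s - a\<bar> \<le> \<bar>b\<bar>"
      using s ab by (auto simp: closed_segment_eq_real_ivl split: if_splits)
    have "\<bar>w s - w a\<bar> \<le> L * \<bar>s - a\<bar>"
      by (rule L[OF s(1) ab(1)])
    also have "\<dots> \<le> L * \<bar>b\<bar>"
      by (rule mult_left_mono[OF s(2) \<open>0 \<le> L\<close>])
    finally show ?thesis .
  qed
  then have "\<bar>(W (a + b) - w a * (a + b)) - (W a - w a * a)\<bar> \<le> (L * \<bar>b\<bar>) * \<bar>(a + b) - a\<bar>"
    by (intro derivative_bound_segment[of "\<lambda>s. W s - w a * s" "\<lambda>s. w s - w a"]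
        DERIV_diff W_deriv DERIV_cmult_Id)
  then show ?thesis
    by (simp add: algebra_simps)
qed

end

section \<open>Differentiability of the potential energy operator\<close>

locale kernel_potential = kernel + potential
begin

lemma controlled_W: "\<exists>f. controlled f (\<lambda>x y. W (apply_bdd u y - apply_bdd u x))"
  and controlled_w: "\<exists>f. controlled f (\<lambda>x y. w (apply_bdd u y - apply_bdd u x))"
  using W_bound[of "2 * sup_norm u"] w_bound[of "2 * sup_norm u"]
  by (blast intro: controlled_diff_op[OF W_measurable] controlled_diff_op[OF w_measurable])+

text \<open>The derivative of \<open>diff_op W\<close> at \<open>u\<close> in direction
  \<open>h\<close>, found by differentiating formally under the integral.\<close>

definition W_diff :: "bdd \<Rightarrow> bdd \<Rightarrow> bdd" where
  "W_diff u h = kint (\<lambda>x y. w (u y - u x) * (h y - h x))"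

text \<open>The constant depends on \<open>u\<close> but not on \<open>h\<close>, which is what
  makes \<open>W_diff u\<close> a bounded operator.\<close>

lemma controlled_W_diff:
  "\<exists>M. \<forall>h. controlled (M *\<^sub>R h) (\<lambda>x y. w (apply_bdd u y - apply_bdd u x) * (apply_bdd h y - apply_bdd h x))"
proof -
  obtain M where M: "\<And>s. \<bar>s\<bar> \<le> 2 * sup_norm u \<Longrightarrow> \<bar>w s\<bar> \<le> M"
    using w_bound[of "2 * sup_norm u"] by blast
  show ?thesis
    by (intro exI[of _ "\<bar>M\<bar>"] allI controlled_scaled)
      (auto simp: abs_mult intro!: mult_right_mono M diff_bound)
qed

lemma bounded_linear_W_diff: "bounded_linear (W_diff u)"
proof -
  obtain M where M: "\<And>h. controlled (M *\<^sub>R h) (\<lambda>x y. w (apply_bdd u y - apply_bdd u x) * (apply_bdd h y - apply_bdd h x))"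
    using controlled_W_diff[of u] by blast
  show ?thesis
  proof (rule bounded_linear_intro[of _ "2 * mass * \<bar>M\<bar>"])
    show "W_diff u (g + h) = W_diff u g + W_diff u h" for g h
      using M[of "g + h"] unfolding W_diff_def
      by (subst kint_add[OF M[of g] M[of h], symmetric]) (auto simp: algebra_simps)
    show "W_diff u (c *\<^sub>R h) = c *\<^sub>R W_diff u h" for c h
      using M[of "c *\<^sub>R h"] unfolding W_diff_def
      by (subst kint_scaleR[OF M[of h], symmetric]) (auto simp: algebra_simps)
    show "norm (W_diff u h) \<le> norm h * (2 * mass * \<bar>M\<bar>)" for h
      using norm_kint_le[OF M[of h]] by (simp add: W_diff_def mult_ac)
  qed
qed

text \<open>The Taylor remainder of the integrand is quadratic in \<open>h y - h x\<close>. One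
  factor is bounded by the sup norm and the other provides integrability, so the remainder is of
  order \<open>norm h\<close> squared.\<close>

lemma diff_op_W_has_derivative: "(diff_op W has_derivative W_diff u) (at u)"
proof -
  \<comment> \<open>This radius contains all differences of values of \<open>u\<close> and of
    \<open>u + h\<close> when \<open>sup_norm h \<le> 1\<close>.\<close>
  define r where "r = 2 * (sup_norm u + 1)"
  obtain L where L: "0 \<le> L" "\<And>a b. \<bar>a\<bar> \<le> r \<Longrightarrow> \<bar>b\<bar> \<le> r \<Longrightarrow> \<bar>w a - w b\<bar> \<le> L * \<bar>a - b\<bar>"
    using w_local_Lipschitz[of r] by blast
  obtain M where M: "\<And>h. controlled (M *\<^sub>R h) (\<lambda>x y. w (u y - u x) * (apply_bdd h y - apply_bdd h x))"
    using controlled_W_diff[of u] by blast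
  have rem: "norm (diff_op W v - diff_op W u - W_diff u (v - u)) \<le> 4 * mass * L * norm (v - u) * norm (v - u)"
    if v: "norm (v - u) < 1" for v
  proof -
    define h where "h = v - u"
    have h: "sup_norm h \<le> 1" "v = u + h"
      using v sup_norm_le_norm[of "v - u"] by (auto simp: h_def)
    define R where "R x y = W (v y - v x) - W (u y - u x) - w (u y - u x) * (h y - h x)" for x y
    have hd: "\<bar>h y - h x\<bar> \<le> 2 * sup_norm h" for x y
      by (rule diff_bound)
    have "\<bar>R x y\<bar> \<le> L * (2 * sup_norm h) * \<bar>h y - h x\<bar>" for x y
    proof -
      have "\<bar>W ((u y - u x) + (h y - h x)) - W (u y - u x) - w (u y - u x) * (h y - h x)\<bar>
          \<le> L * \<bar>h y - h x\<bar> * \<bar>h y - h x\<bar>"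
      proof (rule W_remainder[OF L(2) L(1)])
        show "\<bar>u y - u x\<bar> \<le> r" "\<bar>u y - u x + (h y - h x)\<bar> \<le> r"
          using diff_bound[of u y x] hd[of y x] h(1) by (auto simp: r_def)
      qed
      also have "\<dots> \<le> L * (2 * sup_norm h) * \<bar>h y - h x\<bar>"
        using L(1) hd[of y x] by (intro mult_right_mono mult_left_mono) auto
      finally show ?thesis
        by (simp add: R_def h(2) algebra_simps)
    qed
    then have cR: "controlled (\<bar>L * (2 * sup_norm h)\<bar> *\<^sub>R h) R"
      by (intro controlled_scaled) (auto simp: R_def)
    obtain f g where f: "controlled f (\<lambda>x y. W (v y - v x))" and g: "controlled g (\<lambda>x y. W (u y - u x))"
      using controlled_W by metis
    have "kint R = diff_op W v - diff_op W u - W_diff u h"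
      by (intro bdd_eqI)
        (simp add: kint_apply[OF cR] diff_op_def W_diff_def kint_apply[OF f] kint_apply[OF g]
          kint_apply[OF M[of h]] R_def right_diff_distrib[of "al _" "W _ - W _"] right_diff_distrib[of "al _" "W _"]
          slice_integrable[OF f] slice_integrable[OF g] slice_integrable[OF M[of h]])
    then have "norm (diff_op W v - diff_op W u - W_diff u h) \<le> 2 * mass * (L * (2 * sup_norm h) * norm h)"
      using norm_kint_le[OF cR] L(1) by simp
    also have "\<dots> \<le> 2 * mass * (L * (2 * norm h) * norm h)"
      using L(1) mass_nonneg by (intro mult_left_mono mult_right_mono sup_norm_le_norm) auto
    finally show ?thesis
      by (simp add: h_def mult_ac)
  qed
  show ?thesis
  proof (rule has_derivativeI_sandwich[of 1])
    show "bounded_linear (W_diff u)" by (rule bounded_linear_W_diff)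
    show "norm (diff_op W v - diff_op W u - W_diff u (v - u)) / norm (v - u) \<le> 4 * mass * L * norm (v - u)"
      if "v \<noteq> u" "dist v u < 1" for v
      using rem[of v] that by (simp add: dist_norm divide_le_eq mult_ac)
    show "((\<lambda>v. 4 * mass * L * norm (v - u)) \<longlongrightarrow> 0) (at u)"
      by (auto intro!: tendsto_eq_intros)
  qed auto
qed

end

section \<open>Global existence\<close>

lemma has_real_derivative_nonpos_le:
  fixes g :: "real \<Rightarrow> real"
  assumes "a \<le> b"
    and g: "\<And>s. a \<le> s \<Longrightarrow> s \<le> b \<Longrightarrow> (g has_real_derivative g' s) (at s within {a..b})"
    and g': "\<And>s. a \<le> s \<Longrightarrow> s \<le> b \<Longrightarrow> g' s \<le> 0"
  shows "g b \<le> g a"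
proof (rule DERIV_nonpos_imp_decreasing_open[OF \<open>a \<le> b\<close>])
  fix x assume "a < x" "x < b"
  then show "\<exists>y. DERIV g x :> y \<and> y \<le> 0"
    using g[of x] g'[of x] by (auto simp: at_within_Icc_at)
next
  show "continuous_on {a..b} g"
    using g by (intro DERIV_continuous_on) auto
qed

section \<open>The truncated equation\<close>

definition clamp_abs :: "real \<Rightarrow> real \<Rightarrow> real" where
  "clamp_abs r s = max (- r) (min r s)"

lemma clamp_abs_le: "0 \<le> r \<Longrightarrow> \<bar>clamp_abs r s\<bar> \<le> r"
  and clamp_abs_le_arg: "0 \<le> r \<Longrightarrow> \<bar>clamp_abs r s\<bar> \<le> \<bar>s\<bar>"
  and clamp_abs_eq: "\<bar>s\<bar> \<le> r \<Longrightarrow> clamp_abs r s = s"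
  and clamp_abs_0: "0 \<le> r \<Longrightarrow> clamp_abs r 0 = 0"
  and clamp_abs_Lipschitz: "\<bar>clamp_abs r s - clamp_abs r s'\<bar> \<le> \<bar>s - s'\<bar>"
  by (auto simp: clamp_abs_def max_def min_def abs_if split: if_splits)

text \<open>
  The factor \<open>\<bar>s\<bar>\<close>, which requires levels bounded away from zero, is what makes the clamped
  operator continuous in the level with respect to the integral norm.
\<close>

lemma clamp_abs_level:
  assumes "1 \<le> r" "1 \<le> r'"
  shows "\<bar>clamp_abs r s - clamp_abs r' s\<bar> \<le> \<bar>r - r'\<bar> * \<bar>s\<bar>"
proof (cases "\<bar>s\<bar> \<le> min r r'")
  case True
  then show ?thesis by (simp add: clamp_abs_eq)
next
  case False
  then have "1 \<le> \<bar>s\<bar>" using assms by auto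
  have "\<bar>clamp_abs r s - clamp_abs r' s\<bar> \<le> \<bar>r - r'\<bar>"
    using assms by (auto simp: clamp_abs_def max_def min_def abs_if)
  also have "\<dots> \<le> \<bar>r - r'\<bar> * \<bar>s\<bar>"
    using mult_left_mono[OF \<open>1 \<le> \<bar>s\<bar>\<close>, of "\<bar>r - r'\<bar>"] by simp
  finally show ?thesis .
qed

lemma clamp_abs_measurable [measurable]: "clamp_abs r \<in> borel_measurable borel"
  unfolding clamp_abs_def by measurable

context kernel_potential
begin

definition clamped :: "real \<Rightarrow> bdd \<Rightarrow> bdd" where
  "clamped r = diff_op (\<lambda>s. w (clamp_abs r s))"

lemma clamped_eq:
  assumes "2 * sup_norm u \<le> r"
  shows "clamped r u = diff_op w u"
proof -
  have "clamp_abs r (u y - u x) = u y - u x" for x y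
    using diff_bound[of u y x] assms by (intro clamp_abs_eq) linarith
  then show ?thesis
    by (simp add: clamped_def diff_op_def)
qed

text \<open>The clamp is 1-Lipschitz with values where \<open>w\<close> has constant
  \<open>L\<close>. The constant serves all levels up to \<open>R\<close> at once, as needed for a
  level that varies with time.\<close>

lemma clamped_Lipschitz:
  "\<exists>L\<ge>0. \<forall>r u v. 0 \<le> r \<longrightarrow> r \<le> R \<longrightarrow> norm (clamped r u - clamped r v) \<le> L * norm (u - v)"
proof -
  obtain L where L: "0 \<le> L" "\<And>a b. \<bar>a\<bar> \<le> R \<Longrightarrow> \<bar>b\<bar> \<le> R \<Longrightarrow> \<bar>w a - w b\<bar> \<le> L * \<bar>a - b\<bar>"
    using w_local_Lipschitz[of R] by blast
  show ?thesis
  proof (intro exI[of _ "2 * mass * \<bar>L\<bar>"] conjI allI impI)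
    fix r u v assume r: "0 \<le> r" "r \<le> R"
    show "norm (clamped r u - clamped r v) \<le> 2 * mass * \<bar>L\<bar> * norm (u - v)"
      unfolding clamped_def
    proof (rule diff_op_Lipschitz)
      show "\<bar>w (clamp_abs r s) - w (clamp_abs r t)\<bar> \<le> L * \<bar>s - t\<bar>" for s t
      proof -
        have "\<bar>w (clamp_abs r s) - w (clamp_abs r t)\<bar> \<le> L * \<bar>clamp_abs r s - clamp_abs r t\<bar>"
          using clamp_abs_le[OF r(1)] r(2) by (intro L(2)) (auto intro: order_trans)
        also have "\<dots> \<le> L * \<bar>s - t\<bar>"
          by (intro mult_left_mono clamp_abs_Lipschitz L(1))
        finally show ?thesis .
      qed
    qed (simp_all add: clamp_abs_0 r w_0)
  qed (simp add: mass_nonneg)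
qed

text \<open>The constant \<open>2 * mass * L * norm u\<close> depends on the state; that is enough
  for continuity in time at a frozen state, the form required by the existence theorem.\<close>

lemma clamped_level:
  "\<exists>L. \<forall>r r'. 1 \<le> r \<longrightarrow> r \<le> R \<longrightarrow> 1 \<le> r' \<longrightarrow> r' \<le> R \<longrightarrow>
      norm (clamped r u - clamped r' u) \<le> L * \<bar>r - r'\<bar>"
proof -
  obtain L where L: "0 \<le> L" "\<And>a b. \<bar>a\<bar> \<le> R \<Longrightarrow> \<bar>b\<bar> \<le> R \<Longrightarrow> \<bar>w a - w b\<bar> \<le> L * \<bar>a - b\<bar>"
    using w_local_Lipschitz[of R] by blast
  have le: "\<bar>w (clamp_abs r s)\<bar> \<le> L * \<bar>s\<bar>" if r: "1 \<le> r" "r \<le> R" for r s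
  proof -
    have "\<bar>w (clamp_abs r s) - w 0\<bar> \<le> L * \<bar>clamp_abs r s - 0\<bar>"
      using clamp_abs_le[of r s] r by (intro L(2)) auto
    also have "\<dots> \<le> L * \<bar>s\<bar>"
      using clamp_abs_le_arg[of r s] r L(1) by (intro mult_left_mono) auto
    finally show ?thesis by (simp add: w_0)
  qed
  show ?thesis
  proof (intro exI[of _ "2 * mass * L * norm u"] allI impI)
    fix r r' :: real assume r: "1 \<le> r" "r \<le> R" "1 \<le> r'" "r' \<le> R"
    have "norm (clamped r u - clamped r' u) \<le> 2 * mass * \<bar>L * \<bar>r - r'\<bar>\<bar> * norm u"
      unfolding clamped_def
    proof (rule diff_op_coefficient)
      show "\<bar>w (clamp_abs r s) - w (clamp_abs r' s)\<bar> \<le> L * \<bar>r - r'\<bar> * \<bar>s\<bar>" for s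
      proof -
        have "\<bar>w (clamp_abs r s) - w (clamp_abs r' s)\<bar> \<le> L * \<bar>clamp_abs r s - clamp_abs r' s\<bar>"
          using clamp_abs_le[of r s] clamp_abs_le[of r' s] r by (intro L(2)) auto
        also have "\<dots> \<le> L * (\<bar>r - r'\<bar> * \<bar>s\<bar>)"
          using clamp_abs_level[of r r' s] r L(1) by (intro mult_left_mono) auto
        finally show ?thesis by (simp add: mult.assoc)
      qed
    qed (use le r in auto)
    then show "norm (clamped r u - clamped r' u) \<le> 2 * mass * L * norm u * \<bar>r - r'\<bar>"
      using L(1) by (simp add: mult_ac abs_mult)
  qed
qed

lemma continuous_on_clamped:
  assumes rho: "continuous_on S rho" "\<And>t. t \<in> S \<Longrightarrow> 1 \<le> rho t"
  shows "continuous_on S (\<lambda>t. clamped (rho t) u)"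
  unfolding continuous_on
proof
  fix t assume t: "t \<in> S"
  obtain L where L: "\<And>r r'. 1 \<le> r \<Longrightarrow> r \<le> rho t + 1 \<Longrightarrow> 1 \<le> r' \<Longrightarrow> r' \<le> rho t + 1 \<Longrightarrow>
      norm (clamped r u - clamped r' u) \<le> L * \<bar>r - r'\<bar>"
    using clamped_level[of "rho t + 1" u] by blast
  have lim: "(rho \<longlongrightarrow> rho t) (at t within S)"
    using rho(1) t by (auto simp: continuous_on)
  have "((\<lambda>s. clamped (rho s) u - clamped (rho t) u) \<longlongrightarrow> 0) (at t within S)"
  proof (rule Lim_null_comparison)
    have "\<forall>\<^sub>F s in at t within S. rho s < rho t + 1" "\<forall>\<^sub>F s in at t within S. s \<in> S"
      using order_tendstoD(2)[OF lim, of "rho t + 1"] by (auto simp: eventually_at_filter)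
    then show "\<forall>\<^sub>F s in at t within S. norm (clamped (rho s) u - clamped (rho t) u) \<le> L * \<bar>rho s - rho t\<bar>"
      by eventually_elim (use rho(2) t in \<open>auto intro!: L\<close>)
    show "((\<lambda>s. L * \<bar>rho s - rho t\<bar>) \<longlongrightarrow> 0) (at t within S)"
      by (rule tendsto_mult_right_zero, rule tendsto_rabs_zero, rule LIM_zero[OF lim])
  qed
  then show "((\<lambda>t. clamped (rho t) u) \<longlongrightarrow> clamped (rho t) u) (at t within S)"
    by (rule LIM_zero_cancel)
qed

text \<open>The second order equation becomes a first order system for \<open>(u, v)\<close> in
  \<open>bdd \<times> bdd\<close>, with Lipschitz constant \<open>1 + L\<close> on
  \<open>[0, T]\<close>.\<close>

lemma clamped_system_solution:
  assumes rho: "continuous_on {0..} rho" "\<And>t. 0 \<le> t \<Longrightarrow> 1 \<le> rho t"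
  shows "\<exists>u v. u 0 = \<phi> \<and> v 0 = \<psi>
    \<and> (\<forall>t\<ge>0. (u has_vector_derivative v t) (at t within {0..}))
    \<and> (\<forall>t\<ge>0. (v has_vector_derivative clamped (rho t) (u t)) (at t within {0..}))
    \<and> continuous_on {0..} (\<lambda>t. clamped (rho t) (u t))"
proof -
  define f where "f t z = (snd z, clamped (rho t) (fst z))" for t and z :: "bdd \<times> bdd"
  have lip: "\<exists>L\<ge>0. \<forall>t\<in>{0..T}. \<forall>u v. norm (clamped (rho t) u - clamped (rho t) v) \<le> L * norm (u - v)" for T
  proof -
    have "compact (rho ` {0..T})"
      by (intro compact_continuous_image continuous_on_subset[OF rho(1)]) auto
    then have "bounded (rho ` {0..T})"
      by (rule compact_imp_bounded)
    then obtain R where R: "\<forall>t\<in>{0..T}. \<bar>rho t\<bar> \<le> R"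
      unfolding bounded_iff by auto
    obtain L where L: "0 \<le> L"
      "\<forall>r u v. 0 \<le> r \<longrightarrow> r \<le> R \<longrightarrow> norm (clamped r u - clamped r v) \<le> L * norm (u - v)"
      using clamped_Lipschitz[of R] by blast
    show ?thesis
    proof (intro exI[of _ L] conjI ballI allI L(1))
      fix t u v assume t: "t \<in> {0..T}"
      have "0 \<le> rho t" "rho t \<le> R"
        using rho(2)[of t] R t by (fastforce, fastforce)
      then show "norm (clamped (rho t) u - clamped (rho t) v) \<le> L * norm (u - v)"
        using L(2) by blast
    qed
  qed
  have cont: "continuous_on {0..} (\<lambda>t. clamped (rho t) u)" for u
    using rho by (intro continuous_on_clamped) auto
  have f_cont: "continuous_on {0..} (\<lambda>t. f t z)" for z
    unfolding f_def by (intro continuous_on_Pair cont continuous_on_const)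
  have f_lip: "\<exists>L. \<forall>t\<in>{0..T}. \<forall>y z. norm (f t y - f t z) \<le> L * norm (y - z)" for T
  proof -
    obtain L where L: "0 \<le> L" "\<And>t u v. t \<in> {0..T} \<Longrightarrow> norm (clamped (rho t) u - clamped (rho t) v) \<le> L * norm (u - v)"
      using lip[of T] by blast
    show ?thesis
    proof (intro exI[of _ "1 + L"] ballI allI)
      fix t y z assume t: "t \<in> {0..T}"
      have "norm (f t y - f t z) \<le> norm (snd (y - z)) + norm (clamped (rho t) (fst y) - clamped (rho t) (fst z))"
        using norm_Pair_le[of "snd (y - z)" "clamped (rho t) (fst y) - clamped (rho t) (fst z)"]
        by (simp add: f_def)
      also have "\<dots> \<le> norm (snd (y - z)) + L * norm (fst (y - z))"
        using L(2)[OF t] by simp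
      also have "\<dots> \<le> norm (y - z) + L * norm (y - z)"
        using norm_fst_le[of "fst (y - z)" "snd (y - z)"] norm_snd_le[of "snd (y - z)" "fst (y - z)"]
        unfolding prod.collapse by (intro add_mono mult_left_mono L(1))
      finally show "norm (f t y - f t z) \<le> (1 + L) * norm (y - z)"
        by (simp add: distrib_right)
    qed
  qed
  obtain z where z0: "z 0 = (\<phi>, \<psi>)"
    and z: "\<And>t. 0 \<le> t \<Longrightarrow> (z has_vector_derivative f t (z t)) (at t within {0..})"
    using Lipschitz_ode_global_solution[OF f_cont f_lip] by blast
  have u: "((\<lambda>t. fst (z t)) has_vector_derivative snd (z t)) (at t within {0..})" if "0 \<le> t" for t
    using bounded_linear.has_vector_derivative[OF bounded_linear_fst z[OF that]] by (simp add: f_def)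
  show ?thesis
  proof (rule exI[of _ "\<lambda>t. fst (z t)"], rule exI[of _ "\<lambda>t. snd (z t)"], intro conjI allI impI)
    show "((\<lambda>t. snd (z t)) has_vector_derivative clamped (rho t) (fst (z t))) (at t within {0..})" if "0 \<le> t" for t
      using bounded_linear.has_vector_derivative[OF bounded_linear_snd z[OF that]] by (simp add: f_def)
    have u_cont: "continuous_on {0..} (\<lambda>t. fst (z t))"
      using has_vector_derivative_continuous[OF u] by (auto simp: continuous_on_eq_continuous_within)
    have lip': "\<exists>L. \<forall>t\<in>{0..T}. \<forall>u v. norm (clamped (rho t) u - clamped (rho t) v) \<le> L * norm (u - v)" for T
      using lip[of T] by blast
    show "continuous_on {0..} (\<lambda>t. clamped (rho t) (fst (z t)))"
      by (rule continuous_on_Lipschitz_compose[where f = "\<lambda>t. clamped (rho t)", OF cont lip' u_cont])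
  qed (use z0 u in auto)
qed

section \<open>Energy density, flux and conservation\<close>

definition energy_density :: "bdd \<Rightarrow> bdd \<Rightarrow> bdd" where
  "energy_density u v = (1/2) *\<^sub>R mult_bdd v v + diff_op W u"

text \<open>The potential has weight 1/2 here and weight 1 in \<open>energy_density\<close>, because
  integrating over \<open>x\<close> counts every pair of points twice.\<close>

definition energy :: "bdd \<Rightarrow> bdd \<Rightarrow> real" where
  "energy u v = (\<integral>x. (1/2) * (v x)\<^sup>2 + (1/2) * diff_op W u x \<partial>lborel)"

text \<open>This will be the time derivative of \<open>energy_density\<close> along
  solutions.\<close>

definition flux :: "bdd \<Rightarrow> bdd \<Rightarrow> bdd" where
  "flux u v = kint (\<lambda>x y. w (u y - u x) * v y)"

lemma controlled_flux:
  "\<exists>M. controlled (M *\<^sub>R v) (\<lambda>x y. w (apply_bdd u y - apply_bdd u x) * apply_bdd v y)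
    \<and> controlled (M *\<^sub>R v) (\<lambda>x y. w (apply_bdd u y - apply_bdd u x) * apply_bdd v x)"
proof -
  obtain M where M: "\<And>s. \<bar>s\<bar> \<le> 2 * sup_norm u \<Longrightarrow> \<bar>w s\<bar> \<le> M"
    using w_bound[of "2 * sup_norm u"] by blast
  have le: "\<bar>w (u y - u x) * c\<bar> \<le> \<bar>M * c\<bar>" for x y c
  proof -
    have "\<bar>w (u y - u x)\<bar> \<le> \<bar>M\<bar>"
      using M[OF diff_bound[of u y x]] by linarith
    then show ?thesis
      by (simp add: abs_mult mult_right_mono)
  qed
  have y: "\<bar>w (u y - u x) * v y\<bar> \<le> \<bar>(M *\<^sub>R v) x\<bar> + \<bar>(M *\<^sub>R v) y\<bar>" for x y
    using order_trans[OF le[of y x "v y"], of "\<bar>M * v x\<bar> + \<bar>M * v y\<bar>"] by simp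
  have x: "\<bar>w (u y - u x) * v x\<bar> \<le> \<bar>(M *\<^sub>R v) x\<bar> + \<bar>(M *\<^sub>R v) y\<bar>" for x y
    using order_trans[OF le[of y x "v x"], of "\<bar>M * v x\<bar> + \<bar>M * v y\<bar>"] by simp
  show ?thesis
    unfolding controlled_def
    by (intro exI[of _ M] conjI allI x y) measurable
qed

text \<open>A factor depending on \<open>x\<close> alone leaves the integral over \<open>y\<close>,
  which gives the first two identities. For the third, exchanging \<open>x\<close> and
  \<open>y\<close> turns \<open>v y\<close> into \<open>v x\<close> and changes the sign of
  \<open>w\<close>.\<close>

lemma
  fixes u v :: bdd
  shows kint_w_fst: "kint (\<lambda>x y. w (u y - u x) * v x) = mult_bdd v (diff_op w u)"
  and W_diff_eq_flux: "W_diff u v = flux u v - mult_bdd v (diff_op w u)"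
  and integral_flux: "(\<integral>x. flux u v x \<partial>lborel) = - (\<integral>x. v x * diff_op w u x \<partial>lborel)"
proof -
  obtain M where y: "controlled (M *\<^sub>R v) (\<lambda>x y. w (u y - u x) * v y)"
    and x: "controlled (M *\<^sub>R v) (\<lambda>x y. w (u y - u x) * v x)"
    using controlled_flux[of v u] by blast
  obtain f where f: "controlled f (\<lambda>x y. w (u y - u x))"
    using controlled_w by blast
  obtain N where d: "\<forall>h. controlled (N *\<^sub>R h) (\<lambda>x y. w (u y - u x) * (apply_bdd h y - apply_bdd h x))"
    using controlled_W_diff[of u] by blast
  show k: "kint (\<lambda>x y. w (u y - u x) * v x) = mult_bdd v (diff_op w u)"
  proof (rule bdd_eqI)
    fix z
    have "kint (\<lambda>x y. w (u y - u x) * v x) z = (\<integral>y. v z * (al (y - z) * w (u y - u z)) \<partial>lborel)"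
      unfolding kint_apply[OF x] by (simp only: mult_ac)
    then show "kint (\<lambda>x y. w (u y - u x) * v x) z = mult_bdd v (diff_op w u) z"
      by (simp add: diff_op_def kint_apply[OF f])
  qed
  have d': "controlled (N *\<^sub>R v) (\<lambda>x y. w (u y - u x) * v y - w (u y - u x) * v x)"
    using d[rule_format, of v] by (simp add: right_diff_distrib)
  show "W_diff u v = flux u v - mult_bdd v (diff_op w u)"
    unfolding W_diff_def flux_def k[symmetric] kint_diff[OF y x d', symmetric]
    by (simp add: right_diff_distrib)
  have "w (u x - u y) * v x = - (w (u y - u x) * v x)" for x y
    using w_odd[of "u y - u x"] by simp
  then have neg: "(\<lambda>x y. w (u x - u y) * v x) = (\<lambda>x y. - (w (u y - u x) * v x))"
    by (intro ext)
  have "(\<integral>x. flux u v x \<partial>lborel) = (\<integral>x. kint (\<lambda>x y. - (w (u y - u x) * v x)) x \<partial>lborel)"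
    unfolding flux_def integral_kint_swap[OF y] unfolding neg ..
  also have "\<dots> = - (\<integral>x. v x * diff_op w u x \<partial>lborel)"
    unfolding kint_uminus[OF x] k by simp
  finally show "(\<integral>x. flux u v x \<partial>lborel) = - (\<integral>x. v x * diff_op w u x \<partial>lborel)" .
qed

text \<open>The derivative of the kinetic part is \<open>v\<close> times \<open>diff_op w u\<close>,
  which cancels the same term in \<open>W_diff u v\<close> and leaves the flux.\<close>

lemma energy_density_has_vector_derivative:
  assumes u: "(u has_vector_derivative v t) (at t within S)"
    and v: "(v has_vector_derivative diff_op w (u t)) (at t within S)"
  shows "((\<lambda>t. energy_density (u t) (v t)) has_vector_derivative flux (u t) (v t)) (at t within S)"
    and "((\<lambda>t. energy (u t) (v t)) has_vector_derivative 0) (at t within S)"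
proof -
  have W: "((\<lambda>t. diff_op W (u t)) has_vector_derivative W_diff (u t) (v t)) (at t within S)"
    using has_derivative_compose[OF u[unfolded has_vector_derivative_def] diff_op_W_has_derivative]
    by (simp add: has_vector_derivative_def linear_simps(5)[OF bounded_linear_W_diff])
  have vv: "((\<lambda>t. mult_bdd (v t) (v t)) has_vector_derivative 2 *\<^sub>R mult_bdd (v t) (diff_op w (u t))) (at t within S)"
    using bounded_bilinear.has_vector_derivative[OF bounded_bilinear_mult_bdd v v]
    by (rule has_vector_derivative_eq_rhs) (intro bdd_eqI, simp)
  show "((\<lambda>t. energy_density (u t) (v t)) has_vector_derivative flux (u t) (v t)) (at t within S)"
    unfolding energy_density_def
    by (rule has_vector_derivative_eq_rhs[OF has_vector_derivative_add[OF
          bounded_linear.has_vector_derivative[OF bounded_linear_scaleR_right vv] W]])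
      (simp add: W_diff_eq_flux)
  \<comment> \<open>The energy is the integral functional applied to this curve. With
    \<open>I\<close> the integral of \<open>v\<close> times \<open>diff_op w u\<close>, the
    derivative integrates to \<open>I + (- I - I) / 2 = 0\<close>.\<close>
  have "((\<lambda>t. (1/2) *\<^sub>R mult_bdd (v t) (v t) + (1/2) *\<^sub>R diff_op W (u t)) has_vector_derivative
      (1/2) *\<^sub>R 2 *\<^sub>R mult_bdd (v t) (diff_op w (u t)) + (1/2) *\<^sub>R W_diff (u t) (v t)) (at t within S)"
    by (intro has_vector_derivative_add bounded_linear.has_vector_derivative[OF bounded_linear_scaleR_right] vv W)
  from bounded_linear.has_vector_derivative[OF bounded_linear_integral_bdd this]
  show "((\<lambda>t. energy (u t) (v t)) has_vector_derivative 0) (at t within S)"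
    using bdd_integrable[of "flux (u t) (v t)"] bdd_integrable[of "mult_bdd (v t) (diff_op w (u t))"]
    by (simp add: energy_def W_diff_eq_flux integral_flux power2_eq_square)
qed

end

section \<open>The a priori bound and removal of the truncation\<close>

locale peridynamic = kernel_potential +
  fixes q C :: real
  assumes W_nonneg: "0 \<le> W s"
    and q_ge: "4 / 3 \<le> q" and C_pos: "0 < C"
    and growth: "\<bar>w s\<bar> powr q \<le> C * W s"
begin

text \<open>Either \<open>\<bar>w s\<bar> \<le> \<bar>c\<bar> ^ 3\<close>, and the product is at
  most \<open>c ^ 4\<close>, or \<open>\<bar>c\<bar>\<close> is below the cube root of
  \<open>\<bar>w s\<bar>\<close>, and the product is at most
  \<open>\<bar>w s\<bar> powr (4/3)\<close>. The summand 1 covers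
  \<open>\<bar>w s\<bar> \<le> 1\<close>, where raising the exponent to \<open>q\<close> would
  decrease the power.\<close>

lemma weighted_young: "w s * c \<le> 1 + C * W s + c ^ 4"
proof -
  have CW: "0 \<le> C * W s"
    using C_pos W_nonneg by simp
  show ?thesis
  proof (cases "\<bar>w s\<bar> \<le> \<bar>c\<bar> ^ 3")
    case True
    have "w s * c \<le> \<bar>w s\<bar> * \<bar>c\<bar>"
      by (metis abs_ge_self abs_mult)
    also have "\<dots> \<le> \<bar>c\<bar> ^ 3 * \<bar>c\<bar>"
      by (intro mult_right_mono True) auto
    also have "\<dots> = c ^ 4"
      by (simp add: eval_nat_numeral abs_if)
    finally show ?thesis
      using CW by linarith
  next
    case False
    then have pos: "0 < \<bar>w s\<bar>"
      by (metis abs_ge_zero not_le order.strict_trans1 zero_le_power)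
    have "\<bar>c\<bar> ^ 3 \<le> (\<bar>w s\<bar> powr (1/3)) ^ 3"
      using False pos by (simp add: powr_power)
    then have c: "\<bar>c\<bar> \<le> \<bar>w s\<bar> powr (1/3)"
      by (subst (asm) power_mono_iff) auto
    have "w s * c \<le> \<bar>w s\<bar> * \<bar>c\<bar>"
      by (metis abs_ge_self abs_mult)
    also have "\<dots> \<le> \<bar>w s\<bar> * \<bar>w s\<bar> powr (1/3)"
      by (intro mult_left_mono c) auto
    also have "\<dots> = \<bar>w s\<bar> powr (4/3)"
      using pos powr_add[of "\<bar>w s\<bar>" 1 "1/3"] by simp
    also have "\<dots> \<le> 1 + \<bar>w s\<bar> powr q"
    proof (cases "\<bar>w s\<bar> \<le> 1")
      case True
      then have "\<bar>w s\<bar> powr (4/3) \<le> 1"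
        using pos by (intro powr_le1) auto
      then show ?thesis
        using powr_ge_zero[of "\<bar>w s\<bar>" q] by linarith
    next
      case False
      then have "\<bar>w s\<bar> powr (4/3) \<le> \<bar>w s\<bar> powr q"
        using q_ge by (intro powr_mono) auto
      then show ?thesis by simp
    qed
    finally have "w s * c \<le> 1 + \<bar>w s\<bar> powr q" .
    moreover have "0 \<le> c ^ 4"
      by simp
    ultimately show ?thesis
      using growth[of s] by linarith
  qed
qed

lemma A_nonneg: "0 \<le> A"
  using al_nonneg[of 0] al_le[of 0] by linarith

lemma diff_op_W_nonneg: "0 \<le> diff_op W u x"
proof -
  obtain f where "controlled f (\<lambda>x y. W (u y - u x))"
    using controlled_W by blast
  from kint_apply[OF this] show ?thesis
    by (simp add: diff_op_def al_nonneg W_nonneg)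
qed

text \<open>In the quartic term the kernel is replaced by its bound \<open>A\<close> and one factor
  \<open>v\<^sup>2\<close> by \<open>B\<close>; the remaining integral of \<open>v\<^sup>2\<close>
  is controlled by the energy.\<close>

lemma flux_le:
  fixes u v :: bdd
  assumes v: "\<And>x. (v x)\<^sup>2 \<le> B"
  shows "flux u v x \<le> mass + C * diff_op W u x + A * B * (\<integral>y. (v y)\<^sup>2 \<partial>lborel)"
proof -
  obtain M where y: "controlled (M *\<^sub>R v) (\<lambda>x y. w (u y - u x) * v y)"
    using controlled_flux[of v u] by blast
  obtain f where f: "controlled f (\<lambda>x y. W (u y - u x))"
    using controlled_W by blast
  have v2: "integrable lborel (\<lambda>y. (v y)\<^sup>2)"
    using bdd_integrable[of "mult_bdd v v"] by (simp add: power2_eq_square)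
  have "flux u v x = (\<integral>y. al (y - x) * (w (u y - u x) * v y) \<partial>lborel)"
    by (simp add: flux_def kint_apply[OF y])
  also have "\<dots> \<le> (\<integral>y. al (y - x) + C * (al (y - x) * W (u y - u x)) + A * B * (v y)\<^sup>2 \<partial>lborel)"
  proof (rule integral_mono)
    fix z
    have "al (z - x) * (w (u z - u x) * v z) \<le> al (z - x) * (1 + C * W (u z - u x) + (v z) ^ 4)"
      by (intro mult_left_mono weighted_young al_nonneg)
    moreover have "al (z - x) * (v z) ^ 4 \<le> A * (B * (v z)\<^sup>2)"
    proof (intro mult_mono al_le)
      have "(v z) ^ 4 = (v z)\<^sup>2 * (v z)\<^sup>2"
        by (simp add: eval_nat_numeral)
      also have "\<dots> \<le> B * (v z)\<^sup>2"
        by (intro mult_right_mono v) auto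
      finally show "(v z) ^ 4 \<le> B * (v z)\<^sup>2" .
    qed (simp_all add: A_nonneg)
    ultimately show "al (z - x) * (w (u z - u x) * v z)
        \<le> al (z - x) + C * (al (z - x) * W (u z - u x)) + A * B * (v z)\<^sup>2"
      by (simp add: algebra_simps)
  qed (use slice_integrable[OF y] slice_integrable[OF f] v2 shift_integrable in auto)
  also have "\<dots> = mass + C * diff_op W u x + A * B * (\<integral>y. (v y)\<^sup>2 \<partial>lborel)"
    using slice_integrable[OF f] v2 shift_integrable
    by (simp add: shift_integral diff_op_def kint_apply[OF f])
  finally show ?thesis .
qed

theorem global_solution:
  "\<exists>u v. u 0 = \<phi> \<and> v 0 = \<psi>
    \<and> (\<forall>t\<ge>0. (u has_vector_derivative v t) (at t within {0..}))
    \<and> (\<forall>t\<ge>0. (v has_vector_derivative diff_op w (u t)) (at t within {0..}))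
    \<and> continuous_on {0..} (\<lambda>t. diff_op w (u t))"
proof -
  \<comment> \<open>\<open>G\<close> and \<open>H\<close> are strict barriers for \<open>sup e\<close> and \<open>sup \<bar>u\<bar>\<close>: \<open>k\<close> exceeds the growth rate
    \<open>mass + C + 4 A E0\<close> of \<open>sup e\<close>, and \<open>\<bar>v\<bar> \<le> 2 G \<le> H'\<close> as long as \<open>v\<^sup>2 \<le> 2 G\<close>.\<close>
  define E0 where "E0 = energy \<phi> \<psi>"
  define K0 where "K0 = sup_norm (energy_density \<phi> \<psi>) + 1"
  define k where "k = mass + (C + 4 * A * E0) + 1"
  define G where "G t = K0 * exp (k * t)" for t :: real
  define H where "H t = sup_norm \<phi> + 1 + 2 * G t" for t
  define rho where "rho t = 2 * H t" for t
  have energy_ge: "0 \<le> (\<integral>x. (v x)\<^sup>2 \<partial>lborel)" "(\<integral>x. (v x)\<^sup>2 \<partial>lborel) \<le> 2 * energy u v" for u v :: bdd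
  proof -
    have i: "integrable lborel (\<lambda>y. (v y)\<^sup>2)"
      using bdd_integrable[of "mult_bdd v v"] by (simp add: power2_eq_square)
    then have "2 * energy u v = (\<integral>x. (v x)\<^sup>2 \<partial>lborel) + (\<integral>x. diff_op W u x \<partial>lborel)"
      by (simp add: energy_def)
    moreover have "0 \<le> (\<integral>x. diff_op W u x \<partial>lborel)"
      by (simp add: diff_op_W_nonneg)
    ultimately show "(\<integral>x. (v x)\<^sup>2 \<partial>lborel) \<le> 2 * energy u v"
      by linarith
  qed simp
  have E0: "0 \<le> E0"
    using energy_ge(1)[of \<psi>] energy_ge(2)[of \<psi> \<phi>] unfolding E0_def by linarith
  have k: "1 \<le> k"
    using E0 A_nonneg C_pos mass_nonneg by (simp add: k_def)
  have K0: "1 \<le> K0"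
    by (simp add: K0_def)
  have G_ge: "1 \<le> G t" if "0 \<le> t" for t
  proof -
    have "1 * 1 \<le> K0 * exp (k * t)"
      using K0 k that by (intro mult_mono) auto
    then show ?thesis by (simp add: G_def)
  qed
  have G_deriv: "(G has_real_derivative k * G t) (at t within S)" for t S
    unfolding G_def by (auto intro!: derivative_eq_intros)
  have H_deriv: "(H has_real_derivative 2 * (k * G t)) (at t within S)" for t S
    unfolding H_def by (auto intro!: derivative_eq_intros G_deriv)
  have G_cont: "continuous_on S G" and H_cont: "continuous_on S H" for S
    by (rule DERIV_continuous_on[OF G_deriv], rule DERIV_continuous_on[OF H_deriv])
  have "continuous_on {0..} rho"
    unfolding rho_def by (intro continuous_intros H_cont)
  moreover have "1 \<le> rho t" if "0 \<le> t" for t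
    using G_ge[OF that] sup_norm_nonneg[of \<phi>] by (simp add: rho_def H_def del: sup_norm_nonneg)
  ultimately obtain u v where u0: "u 0 = \<phi>" and v0: "v 0 = \<psi>"
    and u': "\<forall>t\<ge>0. (u has_vector_derivative v t) (at t within {0..})"
    and v': "\<forall>t\<ge>0. (v has_vector_derivative clamped (rho t) (u t)) (at t within {0..})"
    and cont: "continuous_on {0..} (\<lambda>t. clamped (rho t) (u t))"
    using clamped_system_solution[of rho \<phi> \<psi>] by blast
  note u = u'[rule_format] and v = v'[rule_format]
  have u_cont: "continuous_on {0..} u" and v_cont: "continuous_on {0..} v"
    using has_vector_derivative_continuous[OF u] has_vector_derivative_continuous[OF v]
    by (auto simp: continuous_on_eq_continuous_within)
  define e where "e t = energy_density (u t) (v t)" for t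
  \<comment> \<open>Negativity of \<open>d\<close> states both barrier conditions at once, so that a
    single continuity argument treats them together.\<close>
  define d where "d t = max (sup_norm (e t) - G t) (sup_norm (u t) - H t)" for t
  have W_cont: "continuous_on UNIV (diff_op W)"
    using has_derivative_continuous[OF diff_op_W_has_derivative]
    by (simp add: continuous_on_eq_continuous_within)
  have "continuous_on {0..} e"
    unfolding e_def energy_density_def
    by (intro continuous_intros bounded_bilinear.continuous_on[OF bounded_bilinear_mult_bdd] v_cont
        continuous_on_compose2[OF W_cont u_cont]) auto
  then have d_cont: "continuous_on {0..} d"
    unfolding d_def by (intro continuous_on_max continuous_on_diff continuous_on_sup_norm u_cont G_cont H_cont)
  have step: "d t < 0" if t: "0 \<le> t" and small: "\<And>s. 0 \<le> s \<Longrightarrow> s \<le> t \<Longrightarrow> d s \<le> 0" for t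
  proof -
    have e_le: "e s x \<le> G s" and u_le: "sup_norm (u s) \<le> H s" if "0 \<le> s" "s \<le> t" for s x
      using small[OF that] sup_norm_upper[of "e s" x] by (auto simp: d_def)
    have e_eq: "e s x = (1/2) * (v s x)\<^sup>2 + diff_op W (u s) x" for s x
      by (simp add: e_def energy_density_def power2_eq_square)
    have uw: "(u has_vector_derivative v s) (at s within {0..t})" if "0 \<le> s" for s
      using u[OF that] by (rule has_vector_derivative_within_subset) auto
    \<comment> \<open>Up to time \<open>t\<close> the level \<open>rho = 2 * H\<close> is at least
      \<open>2 * sup_norm (u s)\<close>, so the clamp is invisible and the energy identities of the
      original equation apply.\<close>
    have vw: "(v has_vector_derivative diff_op w (u s)) (at s within {0..t})" if s: "0 \<le> s" "s \<le> t" for s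
    proof -
      have "clamped (rho s) (u s) = diff_op w (u s)"
        using u_le[OF s] by (intro clamped_eq) (simp add: rho_def)
      then show ?thesis
        using has_vector_derivative_within_subset[OF v[OF s(1)], of "{0..t}"] by auto
    qed
    have e_deriv: "(e has_vector_derivative flux (u s) (v s)) (at s within {0..t})" if s: "0 \<le> s" "s \<le> t" for s
      unfolding e_def by (rule energy_density_has_vector_derivative(1)[OF uw[OF s(1)] vw[OF s]])
    have energy_eq: "energy (u s) (v s) = E0" if s: "0 \<le> s" "s \<le> t" for s
    proof -
      have "\<exists>c. \<forall>s\<in>{0..t}. energy (u s) (v s) = c"
      proof (rule has_derivative_zero_constant)
        fix r assume "r \<in> {0..t}"
        then show "((\<lambda>s. energy (u s) (v s)) has_derivative (\<lambda>h. 0)) (at r within {0..t})"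
          using energy_density_has_vector_derivative(2)[OF uw[of r] vw[of r]]
          by (simp add: has_vector_derivative_def)
      qed simp
      then show ?thesis
        using s t by (auto simp: E0_def u0[symmetric] v0[symmetric])
    qed
    have v2: "(v s x)\<^sup>2 \<le> 2 * G s" if s: "0 \<le> s" "s \<le> t" for s x
      using e_le[OF s, of x] diff_op_W_nonneg[of "u s" x] by (simp add: e_eq)
    have flux_G: "flux (u s) (v s) x \<le> k * G s" if s: "0 \<le> s" "s \<le> t" for s x
    proof -
      have "flux (u s) (v s) x
          \<le> mass + C * diff_op W (u s) x + A * (2 * G s) * (\<integral>y. (v s y)\<^sup>2 \<partial>lborel)"
        by (rule flux_le[OF v2[OF s]])
      moreover have "mass \<le> mass * G s"
        using mult_left_mono[OF G_ge[OF s(1)] mass_nonneg] by simp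
      moreover have "C * diff_op W (u s) x \<le> C * G s"
      proof (rule mult_left_mono)
        show "diff_op W (u s) x \<le> G s"
          using e_le[OF s, of x] zero_le_power2[of "v s x"] unfolding e_eq by linarith
      qed (use C_pos in simp)
      moreover have "A * (2 * G s) * (\<integral>y. (v s y)\<^sup>2 \<partial>lborel) \<le> A * (2 * G s) * (2 * E0)"
        using energy_ge(2)[of "v s" "u s"] energy_eq[OF s] A_nonneg G_ge[OF s(1)]
        by (intro mult_left_mono) auto
      moreover have "k * G s = mass * G s + C * G s + A * (2 * G s) * (2 * E0) + G s"
        by (simp add: k_def algebra_simps)
      ultimately show ?thesis
        using G_ge[OF s(1)] by linarith
    qed
    have apply_deriv: "((\<lambda>s. apply_bdd (f s) x) has_real_derivative apply_bdd f' x) (at s within {0..t})"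
      if "(f has_vector_derivative f') (at s within {0..t})" for f f' s x
      using bounded_linear.has_vector_derivative[OF bounded_linear_apply_bdd that]
      by (simp add: has_real_derivative_iff_has_vector_derivative)
    \<comment> \<open>Since \<open>e - G\<close> is nonincreasing at each point, the initial gap of
      1 contained in \<open>K0\<close> persists. This gap supplies the strict inequality for the
      continuity argument.\<close>
    have "e t x \<le> G t - 1" for x
    proof -
      have "e t x - G t \<le> e 0 x - G 0"
        using flux_G
        by (intro has_real_derivative_nonpos_le[OF t, of "\<lambda>s. e s x - G s" "\<lambda>s. flux (u s) (v s) x - k * G s"]
            DERIV_diff apply_deriv e_deriv G_deriv) auto
      moreover have "e 0 x - G 0 \<le> - 1"
        using sup_norm_upper[of "energy_density \<phi> \<psi>" x] by (simp add: e_def u0 v0 G_def K0_def)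
      ultimately show ?thesis by linarith
    qed
    moreover have "0 \<le> e t x" for x
      using diff_op_W_nonneg[of "u t" x] by (simp add: e_eq)
    ultimately have "sup_norm (e t) \<le> G t - 1"
      by (intro sup_norm_least) (simp add: abs_of_nonneg)
    moreover have "sup_norm (u t) \<le> H t - 1"
    proof (rule sup_norm_least)
      fix x
      have v_le: "\<bar>v s x\<bar> \<le> 2 * (k * G s)" if s: "0 \<le> s" "s \<le> t" for s
      proof -
        have "G s \<le> k * G s"
          using mult_right_mono[OF k, of "G s"] G_ge[OF s(1)] by simp
        moreover have "\<bar>v s x\<bar> \<le> \<bar>2 * G s\<bar>"
        proof (rule abs_le_square_iff[THEN iffD2])
          \<comment> \<open>As \<open>2 * G s \<ge> 1\<close>, the bound \<open>2 * G s\<close> on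
            \<open>v\<^sup>2\<close> is at most its own square, so no square root is needed.\<close>
          have "2 * G s * 1 \<le> 2 * G s * (2 * G s)"
            using G_ge[OF s(1)] by (intro mult_left_mono) auto
          then show "(v s x)\<^sup>2 \<le> (2 * G s)\<^sup>2"
            using v2[OF s, of x] by (simp add: power2_eq_square)
        qed
        ultimately show ?thesis
          using G_ge[OF s(1)] by linarith
      qed
      have "u t x - H t \<le> u 0 x - H 0"
      proof (rule has_real_derivative_nonpos_le[OF t])
        show "((\<lambda>s. u s x - H s) has_real_derivative v s x - 2 * (k * G s)) (at s within {0..t})"
          if "0 \<le> s" for s
          by (intro DERIV_diff apply_deriv uw H_deriv that)
        show "v s x - 2 * (k * G s) \<le> 0" if "0 \<le> s" "s \<le> t" for s
          using v_le[OF that] by linarith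
      qed
      \<comment> \<open>Unlike \<open>e\<close>, the displacement has no sign, so the comparison
        with \<open>H\<close> is repeated for \<open>- u\<close>.\<close>
      moreover have "- u t x - H t \<le> - u 0 x - H 0"
      proof (rule has_real_derivative_nonpos_le[OF t])
        show "((\<lambda>s. - u s x - H s) has_real_derivative - v s x - 2 * (k * G s)) (at s within {0..t})"
          if "0 \<le> s" for s
          by (intro DERIV_diff DERIV_minus apply_deriv uw H_deriv that)
        show "- v s x - 2 * (k * G s) \<le> 0" if "0 \<le> s" "s \<le> t" for s
          using v_le[OF that] by linarith
      qed
      moreover have "\<bar>u 0 x\<bar> \<le> H 0 - 1"
        using sup_norm_upper[of \<phi> x] G_ge[of 0] unfolding u0 H_def by linarith
      ultimately show "\<bar>u t x\<bar> \<le> H t - 1"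
        by linarith
    qed
    ultimately show "d t < 0"
      by (simp add: d_def)
  qed
  have "d 0 < 0"
    using G_ge[of 0] by (simp add: d_def e_def u0 v0 H_def) (simp add: G_def K0_def)
  then have "d t < 0" if "0 \<le> t" for t
    using negative_by_bootstrap[OF d_cont step _ that] by blast
  then have eq: "clamped (rho t) (u t) = diff_op w (u t)" if "0 \<le> t" for t
    using that by (intro clamped_eq) (force simp: d_def rho_def)
  show ?thesis
  proof (rule exI[of _ u], rule exI[of _ v], intro conjI allI impI u0 v0 u)
    show "(v has_vector_derivative diff_op w (u t)) (at t within {0..})" if "0 \<le> t" for t
      using v[OF that] eq[OF that] by simp
    show "continuous_on {0..} (\<lambda>t. diff_op w (u t))"
      by (rule continuous_on_eq[OF cont]) (simp add: eq)
  qed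
qed

end

section \<open>Transfer to the stated problem\<close>

lemma X_has_deriv_bdd:
  fixes u :: "real \<Rightarrow> bdd"
  assumes "(u has_vector_derivative v) (at t within S)"
  shows "X_has_deriv (\<lambda>s. apply_bdd (u s)) (apply_bdd v) t S"
  unfolding X_has_deriv_def
proof (rule Lim_null_comparison)
  show "((\<lambda>s. norm (u s - u t - (s - t) *\<^sub>R v) / norm (s - t)) \<longlongrightarrow> 0) (at t within S)"
    using assms by (simp add: has_vector_derivative_def has_derivative_iff_norm)
  have "norm (Xnorm (\<lambda>x. (u s x - u t x) / (s - t) - v x)) \<le> norm (u s - u t - (s - t) *\<^sub>R v) / norm (s - t)"
    if "s \<noteq> t" for s
  proof -
    let ?q = "(1 / (s - t)) *\<^sub>R (u s - u t - (s - t) *\<^sub>R v)"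
    have "?q = (1 / (s - t)) *\<^sub>R (u s - u t) - v"
      using that by (simp add: scaleR_diff_right)
    then have "apply_bdd ?q = (\<lambda>x. (u s x - u t x) / (s - t) - v x)"
      by simp
    then show ?thesis
      using Xnorm_bdd_nonneg[of ?q] Xnorm_bdd_le[of ?q] by (simp del: minus_bdd.rep_eq scaleR_bdd.rep_eq)
  qed
  then show "\<forall>\<^sub>F s in at t within S. norm (Xnorm (\<lambda>x. (u s x - u t x) / (s - t) - v x))
      \<le> norm (u s - u t - (s - t) *\<^sub>R v) / norm (s - t)"
    \<comment> \<open>The filter excludes \<open>s = t\<close>, where the quotient would take the
      default value 0.\<close>
    unfolding eventually_at_filter by (intro always_eventually) blast
qed

lemma X_continuous_on_bdd:
  fixes u :: "real \<Rightarrow> bdd"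
  assumes u: "continuous_on S u"
  shows "X_continuous_on S (\<lambda>s. apply_bdd (u s))"
  unfolding X_continuous_on_def
proof (intro ballI, rule Lim_null_comparison)
  fix t assume "t \<in> S"
  then show "((\<lambda>s. norm (u s - u t)) \<longlongrightarrow> 0) (at t within S)"
    using u by (intro tendsto_norm_zero LIM_zero) (auto simp: continuous_on)
  have "norm (Xnorm (\<lambda>x. u s x - u t x)) \<le> norm (u s - u t)" for s
    using Xnorm_bdd_nonneg[of "u s - u t"] Xnorm_bdd_le[of "u s - u t"] by simp
  then show "\<forall>\<^sub>F s in at t within S. norm (Xnorm (\<lambda>x. u s x - u t x)) \<le> norm (u s - u t)"
    by (intro always_eventually allI)
qed

text \<open>A continuous derivative is bounded on the compact interval \<open>[-r, r]\<close>, and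
  the mean value inequality applies there.\<close>

lemma C1_local_Lipschitz:
  fixes w :: "real \<Rightarrow> real"
  assumes w: "\<And>x. w differentiable (at x)" and C1: "continuous_on UNIV (deriv w)"
  shows "\<exists>L\<ge>0. \<forall>a b. \<bar>a\<bar> \<le> r \<longrightarrow> \<bar>b\<bar> \<le> r \<longrightarrow> \<bar>w a - w b\<bar> \<le> L * \<bar>a - b\<bar>"
proof -
  have "compact (deriv w ` {- r..r})"
    by (intro compact_continuous_image continuous_on_subset[OF C1]) auto
  then obtain L where L: "0 < L" "\<forall>y\<in>deriv w ` {- r..r}. norm y \<le> L"
    using compact_imp_bounded bounded_pos by metis
  have deriv: "(w has_real_derivative deriv w s) (at s)" for s
    using w by (simp add: DERIV_deriv_iff_real_differentiable)
  have "\<bar>w a - w b\<bar> \<le> L * \<bar>a - b\<bar>" if ab: "\<bar>a\<bar> \<le> r" "\<bar>b\<bar> \<le> r" for a b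
  proof (rule derivative_bound_segment[OF deriv])
    fix s assume "s \<in> closed_segment b a"
    then have "s \<in> {- r..r}"
      using ab by (auto simp: closed_segment_eq_real_ivl split: if_splits)
    then show "\<bar>deriv w s\<bar> \<le> L"
      using L(2) by auto
  qed
  then show ?thesis
    using L(1) less_imp_le by blast
qed

lemma LBINT_has_real_derivative:
  fixes w :: "real \<Rightarrow> real"
  assumes w: "continuous_on UNIV w"
  shows "((\<lambda>s. LBINT r=ereal 0..ereal s. w r) has_real_derivative w s) (at s)"
proof -
  let ?I = "{- \<bar>s\<bar> - 1..\<bar>s\<bar> + 1}"
  have "((\<lambda>s. LBINT r=ereal 0..ereal s. w r) has_vector_derivative w s) (at s within ?I)"
    by (rule interval_integral_FTC2) (auto intro: continuous_on_subset[OF w])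
  moreover have "at s within ?I = at s"
    by (rule at_within_Icc_at) auto
  ultimately show ?thesis
    by (simp add: has_real_derivative_iff_has_vector_derivative)
qed

theorem theorem4p3:
  fixes \<alpha> w \<phi> \<psi> :: "real \<Rightarrow> real" and q C :: real
  assumes alpha_X: "inX \<alpha>"
    and alpha_even: "\<And>x. \<alpha> (- x) = \<alpha> x"
    and alpha_nonneg: "AE x in lborel. \<alpha> x \<ge> 0"
    and w_diff: "\<And>x. w differentiable (at x)"
    and w_C1: "continuous_on UNIV (deriv w)"
    and w_odd: "\<And>x. w (- x) = - w x"
    and w0: "w 0 = 0"
    and W_nonneg: "\<And>\<eta>. (LBINT \<rho>=ereal 0..ereal \<eta>. w \<rho>) \<ge> 0"
    and q: "q \<ge> 4/3" and C: "C > 0"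
    and growth: "\<And>\<eta>. \<bar>w \<eta>\<bar> powr q \<le> C * (LBINT \<rho>=ereal 0..ereal \<eta>. w \<rho>)"
    and phi: "inX \<phi>" and psi: "inX \<psi>"
  shows "\<exists>u u1 u2 :: real \<Rightarrow> real \<Rightarrow> real.
           (AE x in lborel. u 0 x = \<phi> x) \<and> (AE x in lborel. u1 0 x = \<psi> x) \<and>
           (\<forall>T>0. C2_X T u u1 u2 \<and>
              (\<forall>t. 0 < t \<and> t \<le> T \<longrightarrow>
                 (AE x in lborel. u2 t x = (LINT y|lborel. \<alpha> (y - x) * w (u t y - u t x)))))"
proof -
  obtain B where B: "AE x in lborel. \<bar>\<alpha> x\<bar> \<le> B" and [measurable]: "\<alpha> \<in> borel_measurable borel"
    and \<alpha>_int: "integrable lborel \<alpha>"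
    using alpha_X by (auto simp: inX_def)
  \<comment> \<open>A change on a null set makes the bounds hold everywhere. The cut-off condition
    involves only the value \<open>\<alpha> x\<close>, so evenness is preserved.\<close>
  define al where "al x = (if 0 \<le> \<alpha> x \<and> \<alpha> x \<le> B then \<alpha> x else 0)" for x
  have al_meas [measurable]: "al \<in> borel_measurable borel"
    unfolding al_def by measurable
  have al_eq: "AE x in lborel. \<alpha> x = al x"
    using B alpha_nonneg by eventually_elim (auto simp: al_def)
  define W where "W s = (LBINT r=ereal 0..ereal s. w r)" for s
  have w_cont: "continuous_on UNIV w"
    using w_diff by (intro continuous_at_imp_continuous_on ballI differentiable_imp_continuous_within)
  interpret peridynamic al "\<bar>B\<bar>" w W q C
  proof
    show "integrable lborel al"
      using \<alpha>_int al_eq by (subst integrable_cong_AE[of al _ \<alpha>]) auto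
    show "(W has_real_derivative w s) (at s)" for s
      unfolding W_def by (rule LBINT_has_real_derivative[OF w_cont])
    show "W 0 = 0"
      by (simp add: W_def)
    show "\<exists>L\<ge>0. \<forall>a b. \<bar>a\<bar> \<le> r \<longrightarrow> \<bar>b\<bar> \<le> r \<longrightarrow> \<bar>w a - w b\<bar> \<le> L * \<bar>a - b\<bar>" for r
      by (rule C1_local_Lipschitz[OF w_diff w_C1])
  qed (use q C growth W_nonneg w_odd in \<open>auto simp: al_def alpha_even W_def\<close>)
  obtain \<phi>' where \<phi>': "AE x in lborel. apply_bdd \<phi>' x = \<phi> x"
    using inX_bdd_representative[OF phi] .
  obtain \<psi>' where \<psi>': "AE x in lborel. apply_bdd \<psi>' x = \<psi> x"
    using inX_bdd_representative[OF psi] .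
  obtain u v where u0: "u 0 = \<phi>'" and v0: "v 0 = \<psi>'"
    and u: "\<forall>t\<ge>0. (u has_vector_derivative v t) (at t within {0..})"
    and v: "\<forall>t\<ge>0. (v has_vector_derivative diff_op w (u t)) (at t within {0..})"
    and cont: "continuous_on {0..} (\<lambda>t. diff_op w (u t))"
    using global_solution[of \<phi>' \<psi>'] by blast
  \<comment> \<open>Translates of null sets are null, so for every \<open>x\<close> the integral is
    the same with \<open>\<alpha>\<close> in place of \<open>al\<close>.\<close>
  have eq: "diff_op w (u t) x = (\<integral>y. \<alpha> (y - x) * w (u t y - u t x) \<partial>lborel)" for t x
  proof -
    obtain f where f: "controlled f (\<lambda>x y. w (u t y - u t x))"
      using controlled_w by blast
    have "AE y in lborel. \<alpha> (y - x) = al (y - x)"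
      using AE_borel_affine[of 1 "\<lambda>z. \<alpha> z = al z" "- x"] al_eq by simp
    then have "AE y in lborel. al (y - x) * w (u t y - u t x) = \<alpha> (y - x) * w (u t y - u t x)"
      by eventually_elim simp
    then show ?thesis
      unfolding diff_op_def kint_apply[OF f] by (intro integral_cong_AE) auto
  qed
  have "C2_X T (\<lambda>t. apply_bdd (u t)) (\<lambda>t. apply_bdd (v t)) (\<lambda>t. apply_bdd (diff_op w (u t)))" for T
    unfolding C2_X_def
  proof (intro conjI ballI inX_bdd X_has_deriv_bdd X_continuous_on_bdd)
    fix t assume "t \<in> {0..T}"
    then have t: "0 \<le> t" by simp
    show "(u has_vector_derivative v t) (at t within {0..T})"
      by (rule has_vector_derivative_within_subset[OF u[rule_format, OF t]]) auto
    show "(v has_vector_derivative diff_op w (u t)) (at t within {0..T})"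
      by (rule has_vector_derivative_within_subset[OF v[rule_format, OF t]]) auto
  next
    show "continuous_on {0..T} (\<lambda>t. diff_op w (u t))"
      by (rule continuous_on_subset[OF cont]) auto
  qed
  then show ?thesis
    using \<phi>' \<psi>' u0 v0 eq
    by (intro exI[of _ "\<lambda>t. apply_bdd (u t)"] exI[of _ "\<lambda>t. apply_bdd (v t)"]
        exI[of _ "\<lambda>t. apply_bdd (diff_op w (u t))"]) simp
qed

end
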